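(* Let $n,m$ be positive integers, $\mathbf a\in\mathbb N^n$ with $a_1>0$, and $d\in\{0,1,\dots,nm\}$. If $m>1$, then $$f_d^{(n,m)}(\mathbf a)=\sum_{\mathbf j\in\{0,1\}^n}\sum_{k=0}^d\binom{\beta_{\mathbf j,\mathbf a}}{k}f^{(n,m-1)}_{d-k-\gamma_{\mathbf j,\mathbf a}}(\mathbf j).$$ For $m=1$ and every $\mathbf j\in\{0,1\}^n$, $$f_d^{(n,1)}(\mathbf j)=[x^{d+k}]\prod_{i=1}^k\bigl((x+1)^{c_i+1}-1\bigr),$$ where $(c_1,\dots,c_k)=\mathrm{sgn}(\mathbf j)$.
   Context: $G(n,m)$ is the directed graph with vertex set $\{(i,j):1\le i\le n,0\le j\le m\}\cup\{s\}$ and edges $((i,j),(i,j+1))$ ($1\le i\le n$, $0\le j\le m-1$), $((i,j),(i+1,j))$ ($1\le i\le n-1$, $0\le j\le m$), $((n,j),s)$ ($0\le j\le m$). For $\mathbf a\in\mathbb N^n$, $\mathcal F_{G(n,m)}(\mathbf a)$ is the polytope of nonnegative real edge weightings whose outflow minus inflow is $a_i$ at $(i,0)$, $-\sum_i a_i$ at $s$, and $0$ elsewhere; $f_d^{(n,m)}(\mathbf a)$ is its number of $d$-dimensional faces, and $f_e:=0$ for $e<0$. Block structure: if $p_1=1<p_2<\dots<p_\ell$ are the indices with $a_{p_t}>0$ and $p_{\ell+1}:=n+1$, the blocks of $\mathbf j$ according to $\mathbf a$ are $B_t=(j_{p_t},\dots,j_{p_{t+1}-1})$, $t=1,\dots,\ell$.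 $\beta_{\mathbf j,\mathbf a}$ is the number of blocks containing at least one $1$, $b_{\mathbf j}$ is the total number of $1$'s in $\mathbf j$, and $\gamma_{\mathbf j,\mathbf a}=b_{\mathbf j}-\beta_{\mathbf j,\mathbf a}$. Signature: for a vector $\mathbf v$ with $v_1>0$, $\mathrm{sgn}(\mathbf v)=(c_1,\dots,c_k)$ where $\mathbf v=( *,0^{c_1-1},*,0^{c_2-1},\dots,*,0^{c_k-1})$, each $*$ a positive entry; for $\mathbf j\in\{0,1\}^n$ with leading zeros, $\mathrm{sgn}(\mathbf j)$ is the signature of $\mathbf j$ with its leading zeros deleted, and for $\mathbf j=\mathbf 0$ it is empty ($k=0$, empty product $=1$). $[x^r]P$ denotes the coefficient of $x^r$ in $P$. *)

theory Defs
  imports "HOL-Analysis.Analysis" "HOL-Library.Function_Algebras"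
    "HOL-Computational_Algebra.Polynomial"
begin

instantiation "fun" :: (type, real_vector) real_vector
begin
definition scaleR_fun :: "real \<Rightarrow> ('a \<Rightarrow> 'b) \<Rightarrow> 'a \<Rightarrow> 'b"
  where "scaleR_fun r f = (\<lambda>x. r *\<^sub>R f x)"
instance
  by standard (simp_all add: scaleR_fun_def fun_eq_iff scaleR_add_right scaleR_add_left)
end

definition affdim :: "'a::real_vector set \<Rightarrow> int" where
  "affdim F = (if F = {} then -1 else
     int (GREATEST k. \<exists>S. S \<subseteq> F \<and> finite S \<and> card S = k + 1 \<and> \<not> affine_dependent S))"

datatype vert = Node nat nat | Sink

definition gverts :: "nat \<Rightarrow> nat \<Rightarrow> vert set" where
  "gverts n m = {Node i j | i j. 1 \<le> i \<and> i \<le> n \<and> j \<le> m} \<union> {Sink}"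

definition gedges :: "nat \<Rightarrow> nat \<Rightarrow> (vert \<times> vert) set" where
  "gedges n m =
     {(Node i j, Node i (j+1)) | i j. 1 \<le> i \<and> i \<le> n \<and> j < m}
   \<union> {(Node i j, Node (i+1) j) | i j. 1 \<le> i \<and> i < n \<and> j \<le> m}
   \<union> {(Node n j, Sink) | j. j \<le> m}"

text \<open>Net flow (outflow minus inflow) prescribed at each vertex.\<close>
fun demand :: "nat \<Rightarrow> (nat \<Rightarrow> nat) \<Rightarrow> vert \<Rightarrow> real" where
  "demand n a (Node i j) = (if j = 0 then real (a i) else 0)"
| "demand n a Sink = - (\<Sum>i=1..n. real (a i))"

text \<open>Edge weightings are functions on vertex pairs vanishing off the edge set
  (so the polytope lives in a copy of R^E).\<close>
definition flow_polytope :: "nat \<Rightarrow> nat \<Rightarrow> (nat \<Rightarrow> nat) \<Rightarrow> (vert \<times> vert \<Rightarrow> real) set" where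
  "flow_polytope n m a =
     {w. (\<forall>e. e \<notin> gedges n m \<longrightarrow> w e = 0)
       \<and> (\<forall>e\<in>gedges n m. 0 \<le> w e)
       \<and> (\<forall>v\<in>gverts n m.
            (\<Sum>e\<in>gedges n m. if fst e = v then w e else 0)
          - (\<Sum>e\<in>gedges n m. if snd e = v then w e else 0) = demand n a v)}"

definition face_count :: "nat \<Rightarrow> nat \<Rightarrow> (nat \<Rightarrow> nat) \<Rightarrow> int \<Rightarrow> nat" where
  "face_count n m a d = (if d < 0 then 0 else
     card {F. F face_of flow_polytope n m a \<and> F \<noteq> {} \<and> affdim F = d})"

definition binvecs :: "nat \<Rightarrow> (nat \<Rightarrow> nat) set" where
  "binvecs n = {j. (\<forall>i. j i \<in> {0,1}) \<and> (\<forall>i. i \<notin> {1..n} \<longrightarrow> j i = 0)}"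

text \<open>End (exclusive) of the block starting at an index p with a_p > 0.\<close>
definition block_end :: "nat \<Rightarrow> (nat \<Rightarrow> nat) \<Rightarrow> nat \<Rightarrow> nat" where
  "block_end n a p = (LEAST q. p < q \<and> (q = n + 1 \<or> (q \<le> n \<and> 0 < a q)))"

definition beta :: "nat \<Rightarrow> (nat \<Rightarrow> nat) \<Rightarrow> (nat \<Rightarrow> nat) \<Rightarrow> nat" where
  "beta n j a = card {p \<in> {1..n}. 0 < a p \<and> (\<exists>i. p \<le> i \<and> i < block_end n a p \<and> j i = 1)}"

definition bones :: "nat \<Rightarrow> (nat \<Rightarrow> nat) \<Rightarrow> nat" where
  "bones n j = card {i \<in> {1..n}. j i = 1}"

definition gamma :: "nat \<Rightarrow> (nat \<Rightarrow> nat) \<Rightarrow> (nat \<Rightarrow> nat) \<Rightarrow> int" where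
  "gamma n j a = int (bones n j) - int (beta n j a)"

text \<open>Signature of (v_1..v_n) after deleting leading zeros: gaps between consecutive
  positive positions, the last one measured to n+1.\<close>
definition signature :: "nat \<Rightarrow> (nat \<Rightarrow> nat) \<Rightarrow> nat list" where
  "signature n v = (let ps = filter (\<lambda>i. 0 < v i) [1..<n+1]
                    in map2 (\<lambda>q p. q - p) (tl ps @ [n+1]) ps)"

end

theory Submission
  imports Defs
begin

text \<open>
  The nonempty faces of the flow polytope correspond to the supports of its flows. An edge set \<open>H\<close>
  is a support iff every node other than the sink has an outgoing edge in \<open>H\<close> exactly when it is a
  source or has an incoming edge in \<open>H\<close>: dividing the flow through a node equally among its
  outgoing edges in \<open>H\<close> gives a flow with support \<open>H\<close>. A flow supported in \<open>H\<close> is determined by how it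
  splits at the nodes with both outgoing edges in \<open>H\<close>, and this splitting can be perturbed
  independently at each of them, so the dimension of the face is the number of these nodes.

  Such an \<open>H\<close> consists of its column 0 and a support for \<open>G(n, m - 1)\<close> whose sources are the
  heads of the horizontal edges \<open>j\<close> leaving column 0. For fixed \<open>j\<close>, the vertical edges of column 0
  are forced except that in each block containing a 1 the edges from its last 1 to the end
  of the block are either all present or all absent; present edges add one to the dimension,
  which is the factor \<open>x ^ \<gamma> * (1 + x) ^ \<beta>\<close> of the generating function.
\<close>

section \<open>Faces and supports\<close>

definition supp :: "('e \<Rightarrow> real) \<Rightarrow> 'e set" where
  "supp w = {e. w e \<noteq> 0}"

lemma eq_0_outside_supp: "supp w \<subseteq> H \<Longrightarrow> e \<notin> H \<Longrightarrow> w e = 0"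
  by (auto simp: supp_def)

text \<open>An interior point of a segment between nonnegative points vanishes exactly where both
  ends do, so restricting the support cuts out a face. Conversely, a nonempty face contains a point
  \<open>w\<close> of maximal support \<open>H\<close>; every point of \<open>P\<close> supported in
  \<open>H\<close> is the end of a segment in \<open>P\<close> with \<open>w\<close> in its
  interior, hence lies in the face. Hypothesis \<open>line\<close> expresses that \<open>P\<close>
  is an affine set intersected with the nonnegative orthant.\<close>

lemma bij_betw_supports_faces:
  fixes P :: "('e \<Rightarrow> real) set"
  assumes "finite E"
    and supp_E: "\<And>w. w \<in> P \<Longrightarrow> supp w \<subseteq> E"
    and nonneg: "\<And>w e. w \<in> P \<Longrightarrow> 0 \<le> w e"
    and line: "\<And>u w t. u \<in> P \<Longrightarrow> w \<in> P \<Longrightarrow> (\<And>e. 0 \<le> w e + t * (u e - w e)) \<Longrightarrow>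
                 (\<lambda>e. w e + t * (u e - w e)) \<in> P"
  shows "bij_betw (\<lambda>H. {w \<in> P. supp w \<subseteq> H}) (supp ` P) {F. F face_of P \<and> F \<noteq> {}}"
    (is "bij_betw ?face _ _")
proof -
  have seg: "(\<lambda>e. (1 - t) * u e + t * w e) \<in> P" if "u \<in> P" "w \<in> P" "0 \<le> t" "t \<le> 1" for u w t
  proof -
    have "(\<lambda>e. (1 - t) * u e + t * w e) = (\<lambda>e. u e + t * (w e - u e))"
      by (simp add: algebra_simps)
    moreover have "0 \<le> u e + t * (w e - u e)" for e
    proof -
      have "0 \<le> (1 - t) * u e + t * w e" using that nonneg by simp
      then show ?thesis by (simp add: algebra_simps)
    qed
    ultimately show ?thesis using line[of w u t] that by simp
  qed
  have face: "?face H face_of P" for H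
    unfolding face_of_def
  proof (intro conjI ballI impI)
    show "convex (?face H)"
      unfolding convex_alt
    proof (intro ballI allI impI)
      fix u w t assume uw: "u \<in> ?face H" "w \<in> ?face H" and t: "(0::real) \<le> t \<and> t \<le> 1"
      have "supp (\<lambda>e. (1 - t) * u e + t * w e) \<subseteq> supp u \<union> supp w"
        by (auto simp: supp_def)
      then show "(1 - t) *\<^sub>R u + t *\<^sub>R w \<in> ?face H"
        using seg[of u w t] uw t by (auto simp: plus_fun_def scaleR_fun_def)
    qed
  next
    fix u w x assume u: "u \<in> P" and w: "w \<in> P" and x: "x \<in> ?face H" and os: "x \<in> open_segment u w"
    from os obtain t where t: "0 < t" "t < 1" "x = (1 - t) *\<^sub>R u + t *\<^sub>R w"
      by (auto simp: in_segment)
    have xe: "x e = (1 - t) * u e + t * w e" for e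
      using t(3) by (simp add: plus_fun_def scaleR_fun_def)
    have "x e = 0 \<longleftrightarrow> u e = 0 \<and> w e = 0" for e
      using t(1,2) nonneg[OF u, of e] nonneg[OF w, of e]
      by (subst xe) (simp add: add_nonneg_eq_0_iff)
    then have "supp u \<subseteq> supp x" "supp w \<subseteq> supp x" by (auto simp: supp_def)
    with x u w show "u \<in> ?face H" "w \<in> ?face H" by auto
  qed auto
  have inj: "inj_on ?face (supp ` P)"
  proof (rule inj_onI)
    fix H K assume "H \<in> supp ` P" "K \<in> supp ` P" and eq: "?face H = ?face K"
    then obtain u w where uw: "u \<in> P" "w \<in> P" "H = supp u" "K = supp w" by auto
    then have "u \<in> ?face H" "w \<in> ?face K" by auto
    then have "u \<in> ?face K" "w \<in> ?face H" using eq by auto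
    then show "H = K" using uw by auto
  qed
  have surj: "F \<in> ?face ` supp ` P" if F: "F face_of P" "F \<noteq> {}" for F
  proof -
    have FP: "F \<subseteq> P" and cF: "convex F" using F(1) by (auto simp: face_of_def)
    have "finite (supp ` F)"
      by (rule finite_subset[of _ "Pow E"]) (use FP supp_E \<open>finite E\<close> in auto)
    then obtain H where H: "H \<in> supp ` F" "\<And>K. K \<in> supp ` F \<Longrightarrow> H \<subseteq> K \<Longrightarrow> H = K"
      using finite_has_maximal[of "supp ` F"] F(2) by (metis image_is_empty)
    then obtain w where w: "w \<in> F" "H = supp w" by auto
    have wP: "w \<in> P" using w FP by auto
    have finH: "finite H" using w wP supp_E \<open>finite E\<close> finite_subset by metis
    have "F = ?face H"
    proof (intro equalityI subsetI)
      fix u assume u: "u \<in> F"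
      \<comment> \<open>The support of a midpoint is the union of the two supports, so the maximal
        \<open>H\<close> contains every support occurring in \<open>F\<close>.\<close>
      let ?x = "(1 - 1/2) *\<^sub>R u + (1/2) *\<^sub>R w"
      have xF: "?x \<in> F"
        by (rule cF[unfolded convex_alt, rule_format]) (use u w(1) in auto)
      have "?x e = 0 \<longleftrightarrow> u e = 0 \<and> w e = 0" for e
        using nonneg[of u e] nonneg[of w e] u wP FP
        by (auto simp: plus_fun_def scaleR_fun_def subset_iff add_nonneg_eq_0_iff)
      then have "supp ?x = supp u \<union> supp w" by (auto simp: supp_def)
      then have "H = supp u \<union> supp w" using H(2)[of "supp ?x"] xF w by auto
      then show "u \<in> ?face H" using u FP by auto
    next
      fix u assume u: "u \<in> ?face H"
      show "u \<in> F"
      proof (cases "u = w")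
        case False
        \<comment> \<open>Chosen such that \<open>u \<le> M * w\<close> pointwise; the summand 1
          keeps \<open>M\<close> positive.\<close>
        define M where "M = 1 + (\<Sum>e\<in>H. u e / w e)"
        have uP: "u \<in> P" using u by auto
        have sumnn: "0 \<le> (\<Sum>e\<in>H. u e / w e)"
          by (intro sum_nonneg divide_nonneg_nonneg nonneg uP wP)
        have M: "1 \<le> M" using sumnn by (simp add: M_def)
        have le: "u e \<le> M * w e" for e
        proof (cases "e \<in> H")
          case True
          then have pos: "w e > 0" using nonneg[OF wP, of e] w by (auto simp: supp_def)
          have "u e / w e \<le> (\<Sum>e\<in>H. u e / w e)"
            by (rule member_le_sum[OF True]) (use finH nonneg uP wP in auto)
          then have "u e / w e \<le> M" by (simp add: M_def)
          then show ?thesis using pos by (simp add: field_simps)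
        next
          case False
          then have "u e = 0" "w e = 0" using u w by (auto simp: supp_def)
          then show ?thesis by simp
        qed
        \<comment> \<open>Extending the segment from \<open>u\<close> to \<open>w\<close> slightly beyond \<open>w\<close> puts \<open>w\<close> in its interior.\<close>
        define t where "t = - 1 / M"
        define z where "z = (\<lambda>e. w e + t * (u e - w e))"
        have zP: "z \<in> P" unfolding z_def
        proof (rule line[OF uP wP])
          fix e
          have "u e / M \<le> w e" using le[of e] M by (simp add: field_simps)
          moreover have "w e / M \<ge> 0" using nonneg[OF wP, of e] M by simp
          ultimately show "0 \<le> w e + t * (u e - w e)"
            by (simp add: t_def diff_divide_distrib)
        qed
        have "w \<in> open_segment u z"
          unfolding in_segment
        proof (intro conjI exI[of _ "M / (M + 1)"])
          show "w = (1 - M / (M + 1)) *\<^sub>R u + (M / (M + 1)) *\<^sub>R z"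
          proof
            fix e
            have "M * z e = M * w e - (u e - w e)"
              using M by (simp add: z_def t_def algebra_simps)
            then have "(M + 1) * w e = u e + M * z e" by (simp add: algebra_simps)
            then have "w e = (u e + M * z e) / (M + 1)" using M by (simp add: field_simps)
            also have "\<dots> = (1 - M / (M + 1)) * u e + M / (M + 1) * z e"
            proof -
              have "1 - M / (M + 1) = 1 / (M + 1)" using M by (simp add: field_simps)
              then show ?thesis by (simp add: add_divide_distrib)
            qed
            finally show "w e = ((1 - M / (M + 1)) *\<^sub>R u + (M / (M + 1)) *\<^sub>R z) e"
              by (simp add: plus_fun_def scaleR_fun_def)
          qed
          show "u \<noteq> z"
          proof
            assume "u = z"
            then have "u e = w e + t * (u e - w e)" for e unfolding z_def by (rule fun_cong)
            then have "(1 - t) * (u e - w e) = 0" for e by (simp add: algebra_simps)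
            moreover have "1 - t \<noteq> 0" using M by (simp add: t_def field_simps)
            ultimately have "u = w" by auto
            with False show False by simp
          qed
        qed (use M in auto)
        then show "u \<in> F" using F(1) uP zP w(1) unfolding face_of_def by blast
      qed (use w in simp)
    qed
    moreover have "H \<in> supp ` P" using w wP by auto
    ultimately show ?thesis by blast
  qed
  show ?thesis
    unfolding bij_betw_def
  proof (intro conjI inj equalityI subsetI)
    fix F assume "F \<in> ?face ` supp ` P"
    then obtain w where "w \<in> P" "F = ?face (supp w)" by auto
    then show "F \<in> {F. F face_of P \<and> F \<noteq> {}}" using face by auto
  qed (use surj in auto)
qed

section \<open>Affine dimension from a basis of directions\<close>

text \<open>The points \<open>w\<close> and \<open>w + b\<close> are affinely independent, which
  bounds the dimension from below. Subtracting one point of an affinely independent subset of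
  \<open>F\<close> from the others gives independent vectors in \<open>span B\<close>, which bounds
  it from above and shows that the \<open>GREATEST\<close> in \<open>affdim\<close> is
  attained.\<close>

lemma affdim_eqI:
  fixes F :: "'a::real_vector set"
  assumes "finite B" "independent B" "w \<in> F"
    and diff: "\<And>u v. u \<in> F \<Longrightarrow> v \<in> F \<Longrightarrow> u - v \<in> span B"
    and dirs: "\<And>b. b \<in> B \<Longrightarrow> w + b \<in> F"
  shows "affdim F = int (card B)"
proof -
  define S where "S = insert w ((+) w ` B)"
  have nz: "0 \<notin> B" using assms(2) dependent_zero by blast
  have S: "S \<subseteq> F" "finite S" using dirs assms(1,3) by (auto simp: S_def)
  have wB: "w \<notin> (+) w ` B" using nz by auto
  then have cardS: "card S = card B + 1"
    using assms(1) by (simp add: S_def card_image)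
  have "(\<lambda>x. - w + x) ` (+) w ` B = B"
    by (simp add: image_image)
  then have indS: "\<not> affine_dependent S"
    using affine_dependent_iff_dependent[OF wB] assms(2) by (simp add: S_def)
  have bound: "k \<le> card B"
    if T: "T \<subseteq> F" "finite T" "card T = k + 1" "\<not> affine_dependent T" for T k
  proof -
    from T have "T \<noteq> {}" by auto
    then obtain t where t: "t \<in> T" by blast
    have "independent ((\<lambda>x. - t + x) ` (T - {t}))"
      using affine_dependent_iff_dependent2[OF t] T(4) by simp
    moreover have "(\<lambda>x. - t + x) ` (T - {t}) \<subseteq> span B"
      using T(1) t diff[of _ t] by auto
    ultimately have "card ((\<lambda>x. - t + x) ` (T - {t})) \<le> card B"
      using independent_span_bound[OF assms(1)] by blast
    moreover have "card ((\<lambda>x. - t + x) ` (T - {t})) = k"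
      using T(2,3) t by (subst card_image) (auto simp: inj_on_def)
    ultimately show ?thesis by simp
  qed
  have "(GREATEST k. \<exists>S. S \<subseteq> F \<and> finite S \<and> card S = k + 1 \<and> \<not> affine_dependent S) = card B"
  proof (rule Greatest_equality)
    show "\<exists>S. S \<subseteq> F \<and> finite S \<and> card S = card B + 1 \<and> \<not> affine_dependent S"
      using S cardS indS by (intro exI[of _ S]) simp
  qed (elim exE conjE, rule bound)
  then show ?thesis using assms(3) by (auto simp: affdim_def)
qed

section \<open>Flows on the grid\<close>

definition hedge :: "nat \<Rightarrow> nat \<Rightarrow> vert \<times> vert" where
  "hedge i j = (Node i j, Node i (Suc j))"

text \<open>The edge into \<open>Sink\<close> counts as the vertical edge of row \<open>n\<close>.
  Thus every node has one horizontal and one vertical outgoing edge, where the horizontal edge of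
  the last column lies outside the graph.\<close>

definition vedge :: "nat \<Rightarrow> nat \<Rightarrow> nat \<Rightarrow> vert \<times> vert" where
  "vedge n i j = (Node i j, if i < n then Node (Suc i) j else Sink)"

lemma hedge_eq_iff [simp]: "hedge i j = hedge i' j' \<longleftrightarrow> i = i' \<and> j = j'"
  by (auto simp: hedge_def)

lemma vedge_eq_iff [simp]: "vedge n i j = vedge n i' j' \<longleftrightarrow> i = i' \<and> j = j'"
  by (auto simp: vedge_def)

lemma hedge_neq_vedge [simp]: "hedge i j \<noteq> vedge n i' j'" "vedge n i' j' \<noteq> hedge i j"
  by (auto simp: hedge_def vedge_def)

lemma gedges_eq:
  assumes "0 < n"
  shows "gedges n m = (\<lambda>(i, j). hedge i j) ` ({1..n} \<times> {..<m}) \<union>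
           (\<lambda>(i, j). vedge n i j) ` ({1..n} \<times> {..m})" (is "_ = ?R")
proof (intro equalityI subsetI)
  fix e assume "e \<in> gedges n m"
  then consider i j where "e = (Node i j, Node i (j+1))" "1 \<le> i" "i \<le> n" "j < m"
    | i j where "e = (Node i j, Node (i+1) j)" "1 \<le> i" "i < n" "j \<le> m"
    | j where "e = (Node n j, Sink)" "j \<le> m"
    unfolding gedges_def by blast
  then show "e \<in> ?R"
  proof cases
    case 1
    then show ?thesis by (intro UnI1 image_eqI[of _ _ "(i, j)"]) (auto simp: hedge_def)
  next
    case 2
    then show ?thesis by (intro UnI2 image_eqI[of _ _ "(i, j)"]) (auto simp: vedge_def)
  next
    case 3
    then show ?thesis using assms
      by (intro UnI2 image_eqI[of _ _ "(n, j)"]) (auto simp: vedge_def)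
  qed
next
  fix e assume "e \<in> ?R"
  then show "e \<in> gedges n m"
    by (fastforce simp: gedges_def hedge_def vedge_def split: if_splits)
qed

lemma finite_gedges: "0 < n \<Longrightarrow> finite (gedges n m)"
  by (simp add: gedges_eq)

lemma hedge_in_gedges_iff: "0 < n \<Longrightarrow> hedge i j \<in> gedges n m \<longleftrightarrow> 1 \<le> i \<and> i \<le> n \<and> j < m"
  by (force simp: gedges_eq)

lemma vedge_in_gedges_iff: "0 < n \<Longrightarrow> vedge n i j \<in> gedges n m \<longleftrightarrow> 1 \<le> i \<and> i \<le> n \<and> j \<le> m"
  by (force simp: gedges_eq)

lemma gedges_cases:
  assumes "0 < n" "e \<in> gedges n m"
  obtains (hedge) i j where "e = hedge i j" "1 \<le> i" "i \<le> n" "j < m"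
    | (vedge) i j where "e = vedge n i j" "1 \<le> i" "i \<le> n" "j \<le> m"
  using assms by (auto simp: gedges_eq)

definition inflow :: "nat \<Rightarrow> (vert \<times> vert \<Rightarrow> real) \<Rightarrow> nat \<Rightarrow> nat \<Rightarrow> real" where
  "inflow n w i j = (if j = 0 then 0 else w (hedge i (j - 1))) +
                    (if i \<le> 1 then 0 else w (vedge n (i - 1) j))"

text \<open>The demand \<open>b\<close> is real-valued, so that differences and multiples of flows
  are covered. The sink is left out because its balance follows from the other vertices.\<close>

definition conserves :: "nat \<Rightarrow> nat \<Rightarrow> (nat \<Rightarrow> real) \<Rightarrow> (vert \<times> vert \<Rightarrow> real) \<Rightarrow> bool" where
  "conserves n m b w \<longleftrightarrow> (\<forall>i\<in>{1..n}. \<forall>j\<le>m.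
     w (hedge i j) + w (vedge n i j) = inflow n w i j + (if j = 0 then b i else 0))"

text \<open>The support condition gives weight 0 to the horizontal edge leaving the last column, so
  one formula serves all columns.\<close>

lemma sum_out_Node:
  assumes "0 < n" "supp w \<subseteq> gedges n m"
  shows "(\<Sum>e\<in>gedges n m. if fst e = Node i j then w e else 0) = w (hedge i j) + w (vedge n i j)"
proof -
  have "(\<Sum>e\<in>gedges n m. if fst e = Node i j then w e else 0) = (\<Sum>e\<in>{hedge i j, vedge n i j}. w e)"
  proof (rule sum.mono_neutral_cong)
    fix e assume e: "e \<in> gedges n m - {hedge i j, vedge n i j}"
    from assms(1) have "e \<in> gedges n m" using e by auto
    with assms(1) show "(if fst e = Node i j then w e else 0) = 0"
      using e by (cases rule: gedges_cases) (auto simp: hedge_def vedge_def)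
  qed (use assms in \<open>auto simp: finite_gedges supp_def hedge_def vedge_def\<close>)
  then show ?thesis by simp
qed

lemma sum_in_Node:
  assumes "0 < n" "supp w \<subseteq> gedges n m" "1 \<le> i" "i \<le> n"
  shows "(\<Sum>e\<in>gedges n m. if snd e = Node i j then w e else 0) = inflow n w i j"
proof -
  define S where "S = (if j = 0 then {} else {hedge i (j - 1)}) \<union>
                      (if i \<le> 1 then {} else {vedge n (i - 1) j})"
  have "(\<Sum>e\<in>gedges n m. if snd e = Node i j then w e else 0) = (\<Sum>e\<in>S. w e)"
  proof (rule sum.mono_neutral_cong)
    fix e assume e: "e \<in> gedges n m - S"
    from assms(1) have "e \<in> gedges n m" using e by auto
    with assms(1) show "(if snd e = Node i j then w e else 0) = 0"
      using e by (cases rule: gedges_cases) (auto simp: hedge_def vedge_def S_def split: if_splits)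
  qed (use assms in \<open>auto simp: finite_gedges supp_def hedge_def vedge_def S_def split: if_splits\<close>)
  then show ?thesis by (auto simp: S_def inflow_def)
qed

lemma gverts_eq: "gverts n m = insert Sink ((\<lambda>(i, j). Node i j) ` ({1..n} \<times> {..m}))"
  by (force simp: gverts_def)

lemma gedges_gverts: "0 < n \<Longrightarrow> e \<in> gedges n m \<Longrightarrow> fst e \<in> gverts n m \<and> snd e \<in> gverts n m"
  by (erule (1) gedges_cases) (auto simp: gverts_def hedge_def vedge_def)

lemma sum_demand: "(\<Sum>v\<in>gverts n m. demand n a v) = 0"
proof -
  have "(\<Sum>v\<in>(\<lambda>(i, j). Node i j) ` ({1..n} \<times> {..m}). demand n a v) =
        (\<Sum>(i, j)\<in>{1..n} \<times> {..m}. if j = 0 then real (a i) else 0)"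
    by (subst sum.reindex) (auto simp: inj_on_def intro!: sum.cong)
  also have "\<dots> = (\<Sum>i\<in>{1..n}. \<Sum>j\<in>{..m}. if j = 0 then real (a i) else 0)"
    by (rule sum.cartesian_product[symmetric])
  also have "\<dots> = (\<Sum>i=1..n. real (a i))" by simp
  finally show ?thesis by (subst gverts_eq) (subst sum.insert, auto)
qed

text \<open>Each edge contributes once positively at its tail and once negatively at its
  head.\<close>

lemma sum_netflow:
  assumes "0 < n"
  shows "(\<Sum>v\<in>gverts n m. (\<Sum>e\<in>gedges n m. if fst e = v then w e else 0)
          - (\<Sum>e\<in>gedges n m. if snd e = v then w e else 0)) = (0::real)"
proof -
  have fin: "finite (gverts n m)" by (simp add: gverts_eq)
  have *: "(\<Sum>v\<in>gverts n m. \<Sum>e\<in>gedges n m. if f e = v then w e else 0) = (\<Sum>e\<in>gedges n m. w e)"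
    if "\<And>e. e \<in> gedges n m \<Longrightarrow> f e \<in> gverts n m" for f
    by (subst sum.swap) (use that fin in \<open>auto intro!: sum.cong\<close>)
  show ?thesis
    unfolding sum_subtractf by (subst (1 2) *) (use gedges_gverts[OF assms] in auto)
qed

lemma mem_flow_polytope_iff:
  assumes "0 < n"
  shows "w \<in> flow_polytope n m a \<longleftrightarrow>
    supp w \<subseteq> gedges n m \<and> (\<forall>e. 0 \<le> w e) \<and> conserves n m (\<lambda>i. real (a i)) w"
proof (cases "supp w \<subseteq> gedges n m")
  case True
  define net where "net v = (\<Sum>e\<in>gedges n m. if fst e = v then w e else 0)
          - (\<Sum>e\<in>gedges n m. if snd e = v then w e else 0)" for v
  have net_Node: "net (Node i j) = w (hedge i j) + w (vedge n i j) - inflow n w i j"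
    if "1 \<le> i" "i \<le> n" for i j
    using sum_out_Node[OF assms True, of i j] sum_in_Node[OF assms True that, of j]
    by (simp add: net_def)
  let ?N = "(\<lambda>(i, j). Node i j) ` ({1..n} \<times> {..m})"
  have fin: "finite ?N" and nS: "Sink \<notin> ?N" by auto
  have cons: "conserves n m (\<lambda>i. real (a i)) w \<longleftrightarrow> (\<forall>v\<in>?N. net v = demand n a v)"
    unfolding conserves_def by (fastforce simp: net_Node algebra_simps)
  \<comment> \<open>The balance condition at the sink follows from those at the other vertices.\<close>
  have "net Sink = demand n a Sink" if "\<forall>v\<in>?N. net v = demand n a v"
  proof -
    have "(\<Sum>v\<in>insert Sink ?N. net v) = (\<Sum>v\<in>insert Sink ?N. demand n a v)"
      using sum_demand[of n a m] sum_netflow[OF assms, where m = m and w = w] by (simp add: net_def gverts_eq)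
    moreover have "(\<Sum>v\<in>?N. net v) = (\<Sum>v\<in>?N. demand n a v)"
      by (rule sum.cong) (use that in auto)
    ultimately show ?thesis unfolding sum.insert[OF fin nS] by simp
  qed
  then have "(\<forall>v\<in>gverts n m. net v = demand n a v) \<longleftrightarrow> conserves n m (\<lambda>i. real (a i)) w"
    unfolding cons gverts_eq by blast
  moreover have "(\<forall>e\<in>gedges n m. 0 \<le> w e) \<longleftrightarrow> (\<forall>e. 0 \<le> w e)"
    using eq_0_outside_supp[OF True] by (metis order_refl)
  moreover have "\<forall>e. e \<notin> gedges n m \<longrightarrow> w e = 0"
    using True by (auto simp: supp_def)
  ultimately show ?thesis using True by (auto simp: flow_polytope_def net_def)
next
  case False
  then show ?thesis by (auto simp: flow_polytope_def supp_def)
qed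

section \<open>Combinatorial description of supports\<close>

text \<open>Only the positivity of each \<open>a i\<close> enters. This later allows flow that
  arrives through a horizontal edge to be treated as a source, whatever its amount.\<close>

definition admissible :: "nat \<Rightarrow> nat \<Rightarrow> (nat \<Rightarrow> nat) \<Rightarrow> (vert \<times> vert) set \<Rightarrow> bool" where
  "admissible n m a H \<longleftrightarrow> H \<subseteq> gedges n m \<and>
     (\<forall>i\<in>{1..n}. \<forall>j\<le>m. hedge i j \<in> H \<or> vedge n i j \<in> H \<longleftrightarrow>
        j = 0 \<and> 0 < a i \<or> j \<noteq> 0 \<and> hedge i (j - 1) \<in> H \<or> i \<noteq> 1 \<and> vedge n (i - 1) j \<in> H)"

definition branch :: "nat \<Rightarrow> (vert \<times> vert) set \<Rightarrow> (nat \<times> nat) set" where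
  "branch n H = {(i, j). hedge i j \<in> H \<and> vedge n i j \<in> H}"

lemma branch_subset: "0 < n \<Longrightarrow> H \<subseteq> gedges n m \<Longrightarrow> branch n H \<subseteq> {1..n} \<times> {..<m}"
  using hedge_in_gedges_iff by (auto simp: branch_def)

lemma finite_branch: "0 < n \<Longrightarrow> H \<subseteq> gedges n m \<Longrightarrow> finite (branch n H)"
  by (rule finite_subset[OF branch_subset]) auto

text \<open>A sum of nonnegative numbers is nonzero iff some summand is; this is applied to both
  sides of the conservation law at each node.\<close>

lemma admissible_supp:
  assumes "0 < n" "w \<in> flow_polytope n m a"
  shows "admissible n m a (supp w)"
  unfolding admissible_def
proof (intro conjI ballI allI impI)
  have w: "supp w \<subseteq> gedges n m" "\<And>e. 0 \<le> w e" "conserves n m (\<lambda>i. real (a i)) w"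
    using assms mem_flow_polytope_iff by auto
  show "supp w \<subseteq> gedges n m" by fact
  fix i j assume i: "i \<in> {1..n}" and j: "j \<le> m"
  have eq: "w (hedge i j) + w (vedge n i j) = inflow n w i j + (if j = 0 then real (a i) else 0)"
    using w(3) i j by (auto simp: conserves_def)
  have "hedge i j \<in> supp w \<or> vedge n i j \<in> supp w \<longleftrightarrow> w (hedge i j) + w (vedge n i j) \<noteq> 0"
    using w(2) by (auto simp: supp_def add_nonneg_eq_0_iff)
  also have "\<dots> \<longleftrightarrow> j = 0 \<and> 0 < a i \<or> j \<noteq> 0 \<and> hedge i (j - 1) \<in> supp w \<or>
      i \<noteq> 1 \<and> vedge n (i - 1) j \<in> supp w"
    unfolding eq inflow_def using i w(2) by (auto simp: supp_def add_nonneg_eq_0_iff)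
  finally show "hedge i j \<in> supp w \<or> vedge n i j \<in> supp w \<longleftrightarrow>
      j = 0 \<and> 0 < a i \<or> j \<noteq> 0 \<and> hedge i (j - 1) \<in> supp w \<or>
      i \<noteq> 1 \<and> vedge n (i - 1) j \<in> supp w" .
qed

text \<open>In a set \<open>H\<close> of edges, the throughput \<open>z\<close> of a node is passed on along its only
  outgoing edge in \<open>H\<close>; if both outgoing edges lie in \<open>H\<close>, it is divided so that their
  difference is the free parameter \<open>c i j\<close>.\<close>

definition hpart :: "nat \<Rightarrow> (vert \<times> vert) set \<Rightarrow> (nat \<Rightarrow> nat \<Rightarrow> real) \<Rightarrow> nat \<Rightarrow> nat \<Rightarrow> real \<Rightarrow> real" where
  "hpart n H c i j z =
     (if hedge i j \<in> H then if vedge n i j \<in> H then (z + c i j) / 2 else z else 0)"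

definition vpart :: "nat \<Rightarrow> (vert \<times> vert) set \<Rightarrow> (nat \<Rightarrow> nat \<Rightarrow> real) \<Rightarrow> nat \<Rightarrow> nat \<Rightarrow> real \<Rightarrow> real" where
  "vpart n H c i j z =
     (if vedge n i j \<in> H then if hedge i j \<in> H then (z - c i j) / 2 else z else 0)"

text \<open>What reaches a node comes from its demand and from the nodes to its left and above, so
  the recursion descends in \<open>i + j\<close>.\<close>

function thru :: "nat \<Rightarrow> (vert \<times> vert) set \<Rightarrow> (nat \<Rightarrow> real) \<Rightarrow> (nat \<Rightarrow> nat \<Rightarrow> real) \<Rightarrow>
    nat \<Rightarrow> nat \<Rightarrow> real" where
  "thru n H b c i j =
     (if j = 0 then b i else hpart n H c i (j - 1) (thru n H b c i (j - 1))) +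
     (if i \<le> 1 then 0 else vpart n H c (i - 1) j (thru n H b c (i - 1) j))"
  by pat_completeness auto
termination by (relation "Wellfounded.measure (\<lambda>(n, H, b, c, i, j). i + j)") auto

declare thru.simps [simp del]

fun split_flow :: "nat \<Rightarrow> (vert \<times> vert) set \<Rightarrow> (nat \<Rightarrow> real) \<Rightarrow> (nat \<Rightarrow> nat \<Rightarrow> real) \<Rightarrow>
    vert \<times> vert \<Rightarrow> real" where
  "split_flow n H b c (Node i j, v) =
     (if (Node i j, v) = hedge i j then hpart n H c i j (thru n H b c i j)
      else if (Node i j, v) = vedge n i j then vpart n H c i j (thru n H b c i j) else 0)"
| "split_flow n H b c (Sink, v) = 0"

lemma split_flow_hedge: "split_flow n H b c (hedge i j) = hpart n H c i j (thru n H b c i j)"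
  by (simp add: hedge_def)

lemma split_flow_vedge: "split_flow n H b c (vedge n i j) = vpart n H c i j (thru n H b c i j)"
  by (simp add: hedge_def vedge_def)

lemma supp_split_flow: "supp (split_flow n H b c) \<subseteq> H"
proof
  fix e assume "e \<in> supp (split_flow n H b c)"
  then have "split_flow n H b c e \<noteq> 0" by (simp add: supp_def)
  then show "e \<in> H"
    by (cases "(n, H, b, c, e)" rule: split_flow.cases)
       (auto simp: hpart_def vpart_def split: if_splits)
qed

lemma split_flow_branch:
  "(i, j) \<in> branch n H \<Longrightarrow>
     split_flow n H b c (hedge i j) - split_flow n H b c (vedge n i j) = c i j"
  by (simp add: branch_def split_flow_hedge split_flow_vedge hpart_def vpart_def field_simps)

text \<open>If a node has an outgoing edge in \<open>H\<close>, the parts add up to its throughput.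
  Otherwise admissibility excludes sources and incoming edges, so the throughput is 0. With
  \<open>b = a\<close> this yields flows, with \<open>b = 0\<close> circulations.\<close>

lemma conserves_split_flow:
  assumes adm: "admissible n m a H" and b: "\<And>i. a i = 0 \<Longrightarrow> b i = 0"
  shows "conserves n m b (split_flow n H b c)"
  unfolding conserves_def
proof (intro ballI allI impI)
  fix i j assume i: "i \<in> {1..n}" and j: "j \<le> m"
  let ?w = "split_flow n H b c"
  have in_eq: "inflow n ?w i j + (if j = 0 then b i else 0) = thru n H b c i j"
    by (subst thru.simps) (simp add: inflow_def split_flow_hedge split_flow_vedge)
  show "?w (hedge i j) + ?w (vedge n i j) = inflow n ?w i j + (if j = 0 then b i else 0)"
  proof (cases "hedge i j \<in> H \<or> vedge n i j \<in> H")
    case True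
    then show ?thesis unfolding in_eq
      by (auto simp: split_flow_hedge split_flow_vedge hpart_def vpart_def field_simps)
  next
    case False
    then have "\<not> (j = 0 \<and> 0 < a i)" "\<not> (j \<noteq> 0 \<and> hedge i (j - 1) \<in> H)"
        "\<not> (i \<noteq> 1 \<and> vedge n (i - 1) j \<in> H)"
      using adm i j unfolding admissible_def by blast+
    then have "thru n H b c i j = 0"
      by (subst thru.simps) (use b i in \<open>auto simp: hpart_def vpart_def\<close>)
    then show ?thesis unfolding in_eq using False
      by (auto simp: split_flow_hedge split_flow_vedge hpart_def vpart_def)
  qed
qed

text \<open>With \<open>c = 0\<close> a branching node halves its throughput, so positivity passes
  along every edge of \<open>H\<close>; the induction follows the flow through the grid.\<close>

lemma thru_pos:
  assumes adm: "admissible n m a H" and b: "\<And>i. 0 \<le> b i" "\<And>i. 0 < a i \<Longrightarrow> 0 < b i"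
    and "1 \<le> i" "i \<le> n" "j \<le> m"
  shows "0 \<le> thru n H b (\<lambda>_ _. 0) i j \<and>
     (hedge i j \<in> H \<or> vedge n i j \<in> H \<longrightarrow> 0 < thru n H b (\<lambda>_ _. 0) i j)"
  using assms(4-6)
proof (induction "i + j" arbitrary: i j rule: less_induct)
  case less
  let ?t = "thru n H b (\<lambda>_ _. 0)"
  let ?x = "if j = 0 then b i else hpart n H (\<lambda>_ _. 0) i (j - 1) (?t i (j - 1))"
  let ?y = "if i \<le> 1 then 0 else vpart n H (\<lambda>_ _. 0) (i - 1) j (?t (i - 1) j)"
  have t: "?t i j = ?x + ?y" by (subst thru.simps) simp
  have IHx: "0 \<le> ?t i (j - 1) \<and> (hedge i (j - 1) \<in> H \<longrightarrow> 0 < ?t i (j - 1))" if "j \<noteq> 0"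
    using less.hyps[of i "j - 1"] less.prems that by auto
  have IHy: "0 \<le> ?t (i - 1) j \<and> (vedge n (i - 1) j \<in> H \<longrightarrow> 0 < ?t (i - 1) j)" if "i \<noteq> 1"
    using less.hyps[of "i - 1" j] less.prems that by auto
  have x: "0 \<le> ?x" using IHx b(1) by (auto simp: hpart_def)
  have y: "0 \<le> ?y" using IHy by (auto simp: vpart_def)
  have "0 < ?t i j" if "hedge i j \<in> H \<or> vedge n i j \<in> H"
  proof -
    have "j = 0 \<and> 0 < a i \<or> j \<noteq> 0 \<and> hedge i (j - 1) \<in> H \<or> i \<noteq> 1 \<and> vedge n (i - 1) j \<in> H"
      using adm less.prems that unfolding admissible_def by auto
    then have "0 < ?x \<or> 0 < ?y"
      using IHx IHy b(2) less.prems by (auto simp: hpart_def vpart_def)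
    then show ?thesis unfolding t using x y by linarith
  qed
  with x y show ?case unfolding t by auto
qed

lemma split_flow_pos:
  assumes "0 < n" and adm: "admissible n m a H"
    and b: "\<And>i. 0 \<le> b i" "\<And>i. 0 < a i \<Longrightarrow> 0 < b i" and "e \<in> H"
  shows "0 < split_flow n H b (\<lambda>_ _. 0) e"
proof -
  have "e \<in> gedges n m" using assms by (auto simp: admissible_def)
  with assms(1) show ?thesis
  proof (cases rule: gedges_cases)
    case (hedge i j)
    then show ?thesis using thru_pos[OF adm b, where i = i and j = j] \<open>e \<in> H\<close>
      by (auto simp: split_flow_hedge hpart_def)
  next
    case (vedge i j)
    then show ?thesis using thru_pos[OF adm b, where i = i and j = j] \<open>e \<in> H\<close>
      by (auto simp: split_flow_vedge vpart_def)
  qed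
qed

section \<open>Dimensions of faces\<close>

text \<open>The directions of the face belonging to \<open>H\<close>: differences of two flows
  supported in \<open>H\<close> lie here.\<close>

definition circulations :: "nat \<Rightarrow> nat \<Rightarrow> (vert \<times> vert) set \<Rightarrow> (vert \<times> vert \<Rightarrow> real) set" where
  "circulations n m H = {u. supp u \<subseteq> H \<and> conserves n m (\<lambda>_. 0) u}"

lemma conserves_diff:
  "conserves n m b u \<Longrightarrow> conserves n m c w \<Longrightarrow> conserves n m (\<lambda>i. b i - c i) (u - w)"
  unfolding conserves_def
proof (intro ballI allI impI)
  fix i j assume *: "\<forall>i\<in>{1..n}. \<forall>j\<le>m. u (hedge i j) + u (vedge n i j) =
      inflow n u i j + (if j = 0 then b i else 0)"
    "\<forall>i\<in>{1..n}. \<forall>j\<le>m. w (hedge i j) + w (vedge n i j) =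
      inflow n w i j + (if j = 0 then c i else 0)" "i \<in> {1..n}" "j \<le> m"
  have "u (hedge i j) + u (vedge n i j) = inflow n u i j + (if j = 0 then b i else 0)"
    "w (hedge i j) + w (vedge n i j) = inflow n w i j + (if j = 0 then c i else 0)"
    using * by blast+
  then show "(u - w) (hedge i j) + (u - w) (vedge n i j) =
      inflow n (u - w) i j + (if j = 0 then b i - c i else 0)"
    by (auto simp: inflow_def fun_diff_def)
qed

lemma conserves_add:
  "conserves n m b u \<Longrightarrow> conserves n m c w \<Longrightarrow> conserves n m (\<lambda>i. b i + c i) (u + w)"
  unfolding conserves_def
proof (intro ballI allI impI)
  fix i j assume *: "\<forall>i\<in>{1..n}. \<forall>j\<le>m. u (hedge i j) + u (vedge n i j) =
      inflow n u i j + (if j = 0 then b i else 0)"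
    "\<forall>i\<in>{1..n}. \<forall>j\<le>m. w (hedge i j) + w (vedge n i j) =
      inflow n w i j + (if j = 0 then c i else 0)" "i \<in> {1..n}" "j \<le> m"
  have "u (hedge i j) + u (vedge n i j) = inflow n u i j + (if j = 0 then b i else 0)"
    "w (hedge i j) + w (vedge n i j) = inflow n w i j + (if j = 0 then c i else 0)"
    using * by blast+
  then show "(u + w) (hedge i j) + (u + w) (vedge n i j) =
      inflow n (u + w) i j + (if j = 0 then b i + c i else 0)"
    by (auto simp: inflow_def plus_fun_def)
qed

lemma conserves_scale:
  "conserves n m b u \<Longrightarrow> conserves n m (\<lambda>i. r * b i) (r *\<^sub>R u)"
  unfolding conserves_def
proof (intro ballI allI impI)
  fix i j assume *: "\<forall>i\<in>{1..n}. \<forall>j\<le>m. u (hedge i j) + u (vedge n i j) =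
      inflow n u i j + (if j = 0 then b i else 0)" "i \<in> {1..n}" "j \<le> m"
  have "r * (u (hedge i j) + u (vedge n i j)) = r * (inflow n u i j + (if j = 0 then b i else 0))"
    using * by simp
  then show "(r *\<^sub>R u) (hedge i j) + (r *\<^sub>R u) (vedge n i j) =
      inflow n (r *\<^sub>R u) i j + (if j = 0 then r * b i else 0)"
    by (auto simp: inflow_def scaleR_fun_def algebra_simps)
qed

lemma subspace_circulations: "subspace (circulations n m H)"
proof (rule subspaceI)
  show "0 \<in> circulations n m H"
    by (simp add: circulations_def supp_def conserves_def inflow_def)
next
  fix u w assume "u \<in> circulations n m H" "w \<in> circulations n m H"
  moreover have "supp (u + w) \<subseteq> supp u \<union> supp w" by (auto simp: supp_def)
  ultimately show "u + w \<in> circulations n m H"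
    using conserves_add[of n m "\<lambda>_. 0" u "\<lambda>_. 0" w] by (auto simp: circulations_def)
next
  fix r u assume "u \<in> circulations n m H"
  then show "r *\<^sub>R u \<in> circulations n m H"
    using conserves_scale[of n m "\<lambda>_. 0" u r]
    by (auto simp: circulations_def supp_def scaleR_fun_def)
qed

text \<open>Linear functionals that recover the free parameters of a splitting; those at the
  branching nodes serve as coordinates on the circulations.\<close>

definition imbalance :: "nat \<Rightarrow> nat \<times> nat \<Rightarrow> (vert \<times> vert \<Rightarrow> real) \<Rightarrow> real" where
  "imbalance n x u = u (hedge (fst x) (snd x)) - u (vedge n (fst x) (snd x))"

lemma linear_imbalance: "linear (imbalance n x)"
  by (rule linearI) (simp_all add: imbalance_def scaleR_fun_def algebra_simps)

text \<open>Zero propagates through the grid by induction on \<open>i + j\<close>. If nothing enters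
  a node, its two outgoing values have sum 0; at a branching node their difference is 0 as well, and
  elsewhere one of them is 0 because its edge is not in \<open>H\<close>.\<close>

lemma circulation_eq_0:
  assumes "0 < n" "H \<subseteq> gedges n m" "u \<in> circulations n m H"
    and bal: "\<And>x. x \<in> branch n H \<Longrightarrow> imbalance n x u = 0"
  shows "u = 0"
proof -
  have supp: "supp u \<subseteq> H" and cons: "conserves n m (\<lambda>_. 0) u"
    using assms(3) by (auto simp: circulations_def)
  have *: "u (hedge i j) = 0 \<and> u (vedge n i j) = 0" if "1 \<le> i" "i \<le> n" "j \<le> m" for i j
    using that
  proof (induction "i + j" arbitrary: i j rule: less_induct)
    case less
    have "inflow n u i j = 0"
      using less.hyps[of i "j - 1"] less.hyps[of "i - 1" j] less.prems by (auto simp: inflow_def)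
    then have sum: "u (hedge i j) + u (vedge n i j) = 0"
      using cons less.prems by (auto simp: conserves_def)
    show ?case
    proof (cases "hedge i j \<in> H \<and> vedge n i j \<in> H")
      case True
      then have "u (hedge i j) - u (vedge n i j) = 0"
        using bal[of "(i, j)"] by (auto simp: branch_def imbalance_def)
      with sum show ?thesis by linarith
    next
      case False
      then have "u (hedge i j) = 0 \<or> u (vedge n i j) = 0" using supp by (auto simp: supp_def)
      with sum show ?thesis by auto
    qed
  qed
  have "u e = 0" for e
  proof (cases "e \<in> gedges n m")
    case True
    with assms(1) show ?thesis by (cases rule: gedges_cases) (use * in auto)
  next
    case False
    then show ?thesis using supp assms(2) by (auto simp: supp_def)
  qed
  then show ?thesis by (simp add: fun_eq_iff)
qed

text \<open>Applying \<open>p x\<close> to a vanishing linear combination isolates the coefficient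
  of \<open>f x\<close>. The value \<open>r\<close> leaves room for vectors that have been scaled
  down.\<close>

lemma independent_biorthogonal:
  fixes f :: "'x \<Rightarrow> 'a::real_vector" and p :: "'x \<Rightarrow> 'a \<Rightarrow> real"
  assumes "finite X" and lin: "\<And>x. linear (p x)" and "r \<noteq> 0"
    and biorth: "\<And>x y. x \<in> X \<Longrightarrow> y \<in> X \<Longrightarrow> p x (f y) = (if x = y then r else 0)"
  shows "inj_on f X" and "independent (f ` X)"
proof -
  show inj: "inj_on f X"
    by (rule inj_onI) (metis biorth \<open>r \<noteq> 0\<close>)
  have "c (f x) = 0" if "(\<Sum>v\<in>f ` X. c v *\<^sub>R v) = 0" "x \<in> X" for c x
  proof -
    have "0 = p x (\<Sum>y\<in>X. c (f y) *\<^sub>R f y)"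
      using that(1) inj lin by (simp add: sum.reindex linear_0)
    also have "\<dots> = (\<Sum>y\<in>X. c (f y) * p x (f y))"
      using lin by (simp add: linear_sum linear_scale)
    also have "\<dots> = (\<Sum>y\<in>X. if x = y then c (f y) * r else 0)"
      by (rule sum.cong) (use biorth that(2) in auto)
    also have "\<dots> = c (f x) * r" using that(2) assms(1) by simp
    finally show ?thesis using \<open>r \<noteq> 0\<close> by simp
  qed
  then show "independent (f ` X)"
    using assms(1) by (subst dependent_finite) auto
qed

text \<open>One circulation per branching node, with imbalance 1 there and 0 at the other branching
  nodes, gives a basis of the directions. Small multiples of these can be added to a flow that is
  positive on all of \<open>H\<close> without leaving the face.\<close>

lemma affdim_flow_face:
  assumes n: "0 < n" and adm: "admissible n m a H"
  shows "affdim {w \<in> flow_polytope n m a. supp w \<subseteq> H} = int (card (branch n H))"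
proof -
  let ?F = "{w \<in> flow_polytope n m a. supp w \<subseteq> H}"
  have HE: "H \<subseteq> gedges n m" using adm by (simp add: admissible_def)
  have finH: "finite H" using HE finite_gedges[OF n] finite_subset by blast
  have finX: "finite (branch n H)" using finite_branch[OF n HE] .
  \<comment> \<open>Equal splitting yields a point of the face that is positive on all of
    \<open>H\<close>.\<close>
  define w0 where "w0 = split_flow n H (\<lambda>i. real (a i)) (\<lambda>_ _. 0)"
  have w0_supp: "supp w0 \<subseteq> H" unfolding w0_def by (rule supp_split_flow)
  have w0_cons: "conserves n m (\<lambda>i. real (a i)) w0"
    unfolding w0_def by (rule conserves_split_flow[OF adm]) auto
  have w0_pos: "0 < w0 e" if "e \<in> H" for e
    unfolding w0_def by (rule split_flow_pos[OF n adm]) (use that in auto)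
  define f where "f x = split_flow n H (\<lambda>_. 0) (\<lambda>i j. if (i, j) = x then 1 else 0)" for x
  have f_circ: "f x \<in> circulations n m H" for x
    unfolding f_def circulations_def
    using supp_split_flow conserves_split_flow[OF adm, of "\<lambda>_. 0"] by blast
  have f_imb: "imbalance n x (f y) = (if x = y then 1 else 0)" if "x \<in> branch n H" for x y
    using split_flow_branch[of "fst x" "snd x" n H] that by (simp add: imbalance_def f_def)
  \<comment> \<open>The inserted 1 makes the minimum exist also for empty \<open>H\<close>.\<close>
  define \<mu> where "\<mu> = Min (insert 1 (w0 ` H))"
  have \<mu>: "0 < \<mu>" "\<And>e. e \<in> H \<Longrightarrow> \<mu> \<le> w0 e"
    using finH w0_pos by (auto simp: \<mu>_def)
  \<comment> \<open>A common bound for all values \<open>\<bar>f x e\<bar>\<close> with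
    \<open>e\<close> in \<open>H\<close>; the summand 1 makes division by \<open>M\<close> safe when
    there is no branching node.\<close>
  define M where "M = 1 + (\<Sum>x\<in>branch n H. \<Sum>e\<in>H. \<bar>f x e\<bar>)"
  have M: "0 < M" by (auto simp: M_def intro!: add_pos_nonneg sum_nonneg)
  define \<epsilon> where "\<epsilon> = \<mu> / M"
  have \<epsilon>: "0 < \<epsilon>" using \<mu> M by (simp add: \<epsilon>_def)
  have small: "\<epsilon> * \<bar>f x e\<bar> \<le> w0 e" if "x \<in> branch n H" "e \<in> H" for x e
  proof -
    have "\<bar>f x e\<bar> \<le> (\<Sum>e\<in>H. \<bar>f x e\<bar>)"
      by (rule member_le_sum) (use that finH in auto)
    also have "\<dots> \<le> (\<Sum>x\<in>branch n H. \<Sum>e\<in>H. \<bar>f x e\<bar>)"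
      by (rule member_le_sum[where f = "\<lambda>x. \<Sum>e\<in>H. \<bar>f x e\<bar>"])
         (use that finX in \<open>auto intro: sum_nonneg\<close>)
    finally have "\<bar>f x e\<bar> \<le> M" by (simp add: M_def)
    then have "\<epsilon> * \<bar>f x e\<bar> \<le> \<epsilon> * M" using \<epsilon> by simp
    also have "\<dots> = \<mu>" using M by (simp add: \<epsilon>_def)
    finally show ?thesis using \<mu>(2)[OF that(2)] by linarith
  qed
  define g where "g x = \<epsilon> *\<^sub>R f x" for x
  have g_circ: "g x \<in> circulations n m H" for x
    unfolding g_def by (rule subspace_scale[OF subspace_circulations f_circ])
  have g_imb: "imbalance n x (g y) = (if x = y then \<epsilon> else 0)" if "x \<in> branch n H" for x y
    using f_imb[OF that] linear_scale[OF linear_imbalance] by (simp add: g_def)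
  have inj: "inj_on g (branch n H)" and ind: "independent (g ` branch n H)"
    using independent_biorthogonal[where p = "imbalance n" and f = g, OF finX linear_imbalance, of \<epsilon>]
      \<epsilon> g_imb by simp_all
  have "affdim ?F = int (card (g ` branch n H))"
  proof (rule affdim_eqI)
    have w0_nonneg: "0 \<le> w0 e" for e
      using w0_pos[of e] eq_0_outside_supp[OF w0_supp, of e] by (cases "e \<in> H") auto
    then show "w0 \<in> ?F"
      using w0_supp w0_cons HE n by (auto simp: mem_flow_polytope_iff)
    fix b assume "b \<in> g ` branch n H"
    then obtain x where x: "x \<in> branch n H" "b = g x" by auto
    have b_supp: "supp (g x) \<subseteq> H" and b_cons: "conserves n m (\<lambda>_. 0) (g x)"
      using g_circ[of x] by (auto simp: circulations_def)
    have "0 \<le> (w0 + g x) e" for e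
    proof (cases "e \<in> H")
      case True
      have "\<bar>g x e\<bar> \<le> w0 e"
        using small[OF x(1) True] \<epsilon> by (simp add: g_def scaleR_fun_def abs_mult)
      then show ?thesis by (simp add: plus_fun_def)
    next
      case False
      then have "w0 e = 0" "g x e = 0" using eq_0_outside_supp w0_supp b_supp by metis+
      then show ?thesis by simp
    qed
    moreover have "supp (w0 + g x) \<subseteq> supp w0 \<union> supp (g x)" by (auto simp: supp_def)
    then have "supp (w0 + g x) \<subseteq> H" using w0_supp b_supp by blast
    ultimately show "w0 + b \<in> ?F"
      using conserves_add[OF w0_cons b_cons] HE n x by (auto simp: mem_flow_polytope_iff)
  next
    fix u v assume u: "u \<in> ?F" and v: "v \<in> ?F"
    have "supp (u - v) \<subseteq> supp u \<union> supp v" by (auto simp: supp_def)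
    moreover have "conserves n m (\<lambda>i. real (a i) - real (a i)) (u - v)"
      by (rule conserves_diff) (use u v n in \<open>auto simp: mem_flow_polytope_iff\<close>)
    ultimately have d_circ: "u - v \<in> circulations n m H"
      using u v by (auto simp: circulations_def)
    \<comment> \<open>The combination with the same imbalances as \<open>u - v\<close>; the
      difference is then a balanced circulation, hence 0.\<close>
    define s where "s = (\<Sum>x\<in>branch n H. (imbalance n x (u - v) / \<epsilon>) *\<^sub>R g x)"
    have "s \<in> circulations n m H" unfolding s_def
      by (intro subspace_sum subspace_scale subspace_circulations g_circ)
    then have "u - v - s \<in> circulations n m H"
      using d_circ subspace_diff[OF subspace_circulations] by blast
    moreover have "imbalance n x (u - v - s) = 0" if x: "x \<in> branch n H" for x
    proof -
      have "imbalance n x s = (\<Sum>y\<in>branch n H. imbalance n y (u - v) / \<epsilon> * imbalance n x (g y))"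
        unfolding s_def by (simp add: linear_sum linear_scale linear_imbalance)
      also have "\<dots> = (\<Sum>y\<in>branch n H. if x = y then imbalance n y (u - v) else 0)"
        by (rule sum.cong) (use g_imb[OF x] \<epsilon> in auto)
      also have "\<dots> = imbalance n x (u - v)" using x finX by simp
      finally show ?thesis by (simp add: linear_diff[OF linear_imbalance])
    qed
    ultimately have "u - v - s = 0"
      by (rule circulation_eq_0[OF n HE])
    then have "u - v = s" by simp
    also have "s \<in> span (g ` branch n H)" unfolding s_def
      by (intro span_sum span_scale span_base) auto
    finally show "u - v \<in> span (g ` branch n H)" .
  qed (use finX ind in auto)
  then show ?thesis using inj by (simp add: card_image)
qed

section \<open>Face numbers as counts of edge sets\<close>

lemma supp_image_flow_polytope:
  assumes "0 < n"
  shows "supp ` flow_polytope n m a = {H. admissible n m a H}"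
proof (intro equalityI subsetI)
  fix H assume "H \<in> {H. admissible n m a H}"
  then have adm: "admissible n m a H" by simp
  let ?w = "split_flow n H (\<lambda>i. real (a i)) (\<lambda>_ _. 0)"
  have pos: "0 < ?w e" if "e \<in> H" for e
    by (rule split_flow_pos[OF assms adm]) (use that in auto)
  then have eq: "supp ?w = H" using supp_split_flow[of n H] by (fastforce simp: supp_def)
  have "0 \<le> ?w e" for e using pos[of e] eq_0_outside_supp[of ?w H e] eq by (cases "e \<in> H") auto
  moreover have "conserves n m (\<lambda>i. real (a i)) ?w"
    by (rule conserves_split_flow[OF adm]) auto
  ultimately have "?w \<in> flow_polytope n m a"
    using eq adm assms by (auto simp: mem_flow_polytope_iff admissible_def)
  then show "H \<in> supp ` flow_polytope n m a" using eq by blast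
qed (use admissible_supp[OF assms] in auto)

text \<open>The bijection between supports and faces turns dimension into the number of branching
  nodes, so what remains is purely combinatorial.\<close>

lemma face_count_eq_card_admissible:
  assumes n: "0 < n"
  shows "face_count n m a (int d) = card {H. admissible n m a H \<and> card (branch n H) = d}"
proof -
  let ?P = "flow_polytope n m a"
  let ?face = "\<lambda>H. {w \<in> ?P. supp w \<subseteq> H}"
  have bij: "bij_betw ?face (supp ` ?P) {F. F face_of ?P \<and> F \<noteq> {}}"
  proof (rule bij_betw_supports_faces[OF finite_gedges[OF n]])
    fix u w t assume u: "u \<in> ?P" and w: "w \<in> ?P" and nn: "\<And>e. 0 \<le> w e + t * (u e - w e)"
    have eq: "(\<lambda>e. w e + t * (u e - w e)) = w + t *\<^sub>R (u - w)"
      by (simp add: fun_eq_iff scaleR_fun_def)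
    \<comment> \<open>The contribution of \<open>t\<close> to the demand is a multiple of
      \<open>a i - a i\<close>, so the demand stays constant along the line.\<close>
    have "conserves n m (\<lambda>i. real (a i) + t * (real (a i) - real (a i))) (w + t *\<^sub>R (u - w))"
      by (intro conserves_add conserves_scale conserves_diff)
         (use u w n in \<open>auto simp: mem_flow_polytope_iff\<close>)
    moreover have "supp (w + t *\<^sub>R (u - w)) \<subseteq> supp u \<union> supp w"
      by (auto simp: supp_def scaleR_fun_def)
    ultimately show "(\<lambda>e. w e + t * (u e - w e)) \<in> ?P"
      using u w nn n unfolding eq[symmetric] by (auto simp: mem_flow_polytope_iff)
  qed (use n in \<open>auto simp: mem_flow_polytope_iff\<close>)
  have inj: "inj_on ?face {H. admissible n m a H}"
    and img: "?face ` {H. admissible n m a H} = {F. F face_of ?P \<and> F \<noteq> {}}"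
    using bij unfolding bij_betw_def supp_image_flow_polytope[OF n] by simp_all
  have "{F. F face_of ?P \<and> F \<noteq> {} \<and> affdim F = int d} =
        ?face ` {H. admissible n m a H \<and> card (branch n H) = d}" (is "?L = ?R")
  proof (intro equalityI subsetI)
    fix F assume F: "F \<in> ?L"
    then have "F \<in> ?face ` {H. admissible n m a H}" unfolding img by simp
    then obtain H where H: "admissible n m a H" "F = ?face H" by blast
    then have "card (branch n H) = d" using F affdim_flow_face[OF n H(1)] by simp
    with H show "F \<in> ?R" by (intro image_eqI[of _ _ H]) auto
  next
    fix F assume "F \<in> ?R"
    then obtain H where H: "admissible n m a H" "card (branch n H) = d" "F = ?face H" by blast
    then have "F \<in> ?face ` {H. admissible n m a H}" by (intro image_eqI[of _ _ H]) auto
    then have "F \<in> {F. F face_of ?P \<and> F \<noteq> {}}" unfolding img .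
    then show "F \<in> ?L" using H affdim_flow_face[OF n H(1)] by simp
  qed
  moreover have "inj_on ?face {H. admissible n m a H \<and> card (branch n H) = d}"
    by (rule inj_on_subset[OF inj]) auto
  ultimately show ?thesis by (simp add: face_count_def card_image)
qed

section \<open>Vertical edges of one column\<close>

abbreviation (input) X :: "int poly" where "X \<equiv> [:0, 1:]"
abbreviation (input) Y :: "int poly" where "Y \<equiv> [:1, 1:]"

lemma Y_eq: "Y = X + 1"
  by (simp add: one_pCons)

text \<open>The sets \<open>V\<close> of rows \<open>i, \<dots>, n\<close> of a column whose vertical edges can be used, when sources
  are at the support of \<open>a\<close>, the horizontal edges used are given by \<open>j\<close>, and \<open>s\<close> tells whether
  the vertical edge entering row \<open>i\<close> is used.\<close>

definition cols_from :: "nat \<Rightarrow> (nat \<Rightarrow> nat) \<Rightarrow> (nat \<Rightarrow> nat) \<Rightarrow> bool \<Rightarrow> nat \<Rightarrow> nat set set" where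
  "cols_from n a j s i = {V. V \<subseteq> {i..n} \<and>
     (\<forall>q\<in>{i..n}. j q = 1 \<or> q \<in> V \<longleftrightarrow> 0 < a q \<or> (if q = i then s else q - 1 \<in> V))}"

text \<open>The exponent counts the branching nodes of the column: rows in which the horizontal and
  the vertical edge are both used.\<close>

definition col_poly :: "nat \<Rightarrow> (nat \<Rightarrow> nat) \<Rightarrow> (nat \<Rightarrow> nat) \<Rightarrow> bool \<Rightarrow> nat \<Rightarrow> int poly" where
  "col_poly n a j s i = (\<Sum>V\<in>cols_from n a j s i. X ^ card {q \<in> V. j q = 1})"

lemma finite_cols_from: "finite (cols_from n a j s i)"
  by (rule finite_subset[of _ "Pow {i..n}"]) (auto simp: cols_from_def)

text \<open>Whether row \<open>i\<close> uses its vertical edge, recorded by \<open>t\<close>, is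
  all that the rows below need to know.\<close>

lemma cols_from_step:
  assumes "i \<le> n" "V \<subseteq> {Suc i..n}"
  shows "(if t then insert i V else V) \<in> cols_from n a j s i \<longleftrightarrow>
    V \<in> cols_from n a j t (Suc i) \<and> (j i = 1 \<or> t \<longleftrightarrow> 0 < a i \<or> s)"
proof -
  have iV: "i \<notin> V" using assms by auto
  let ?W = "if t then insert i V else V"
  have ivl: "{i..n} = insert i {Suc i..n}" using assms by auto
  have W: "?W \<subseteq> {i..n}" using assms by auto
  have "(q - 1 \<in> ?W) = (if q = Suc i then t else q - 1 \<in> V)" if "q \<in> {Suc i..n}" for q
    using that iV by auto
  moreover have "q \<in> ?W \<longleftrightarrow> q \<in> V" "q \<noteq> i" if "q \<in> {Suc i..n}" for q
    using that by auto
  moreover have "i \<in> ?W \<longleftrightarrow> t" using iV by auto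
  ultimately show ?thesis
    using W assms(2) unfolding cols_from_def mem_Collect_eq ivl ball_simps by auto
qed

lemma col_poly_end: "col_poly n a j s (Suc n) = 1"
proof -
  have "cols_from n a j s (Suc n) = {{}}" by (auto simp: cols_from_def)
  then show ?thesis by (simp add: col_poly_def)
qed

text \<open>A row that receives flow must pass it on: if \<open>j i = 1\<close>, the vertical edge
  is optional and costs a factor \<open>X\<close>, since the node then branches; otherwise it is
  forced. A row that receives nothing must use neither edge.\<close>

lemma col_poly_step:
  assumes "i \<le> n"
  shows "col_poly n a j s i =
    (if 0 < a i \<or> s
     then if j i = 1 then col_poly n a j False (Suc i) + X * col_poly n a j True (Suc i)
          else col_poly n a j True (Suc i)
     else if j i = 1 then 0 else col_poly n a j False (Suc i))"
proof -
  \<comment> \<open>\<open>A\<close> and \<open>B\<close> collect the choices for the rows below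
    according to whether the vertical edge of row \<open>i\<close> is absent or present. An absent
    edge needs \<open>j i = 1\<close> exactly when the row receives flow.\<close>
  define A where "A = (if j i = 1 \<longleftrightarrow> 0 < a i \<or> s then cols_from n a j False (Suc i) else {})"
  define B where "B = (if 0 < a i \<or> s then cols_from n a j True (Suc i) else {})"
  have sub: "V \<subseteq> {Suc i..n}" if "V \<in> A \<union> B" for V
    using that by (auto simp: A_def B_def cols_from_def split: if_splits)
  have "V \<in> A \<union> insert i ` B" if V: "V \<in> cols_from n a j s i" for V
  proof -
    have W: "V - {i} \<subseteq> {Suc i..n}" using V by (force simp: cols_from_def)
    have eq: "(if i \<in> V then insert i (V - {i}) else V - {i}) = V" by auto
    have "V - {i} \<in> cols_from n a j (i \<in> V) (Suc i) \<and> (j i = 1 \<or> i \<in> V \<longleftrightarrow> 0 < a i \<or> s)"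
      using cols_from_step[OF assms W, of "i \<in> V" a j s] V unfolding eq by simp
    then show ?thesis
      by (cases "i \<in> V") (auto simp: A_def B_def intro!: image_eqI[of _ _ "V - {i}"])
  qed
  moreover have "V \<in> cols_from n a j s i" if "V \<in> A" for V
    using cols_from_step[OF assms sub[of V], of False a j s] that
    by (auto simp: A_def split: if_splits)
  moreover have "insert i V \<in> cols_from n a j s i" if "V \<in> B" for V
    using cols_from_step[OF assms sub[of V], of True a j s] that
    by (auto simp: B_def split: if_splits)
  ultimately have eq: "cols_from n a j s i = A \<union> insert i ` B" by blast
  have fin: "finite A" "finite B" by (auto simp: A_def B_def finite_cols_from)
  have disj: "A \<inter> insert i ` B = {}" using sub by force
  have inj: "inj_on (insert i) B"
  proof (rule inj_onI)
    fix V W assume VW: "V \<in> B" "W \<in> B" "insert i V = insert i W"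
    have "i \<notin> V" "i \<notin> W" using sub[of V] sub[of W] VW by auto
    then show "V = W" using VW(3) by (simp add: insert_ident)
  qed
  have card: "card {q \<in> insert i V. j q = 1} = of_bool (j i = 1) + card {q \<in> V. j q = 1}"
    if "V \<in> B" for V
  proof -
    have "finite V" "i \<notin> V" using sub[of V] that finite_subset by auto
    moreover have "{q \<in> insert i V. j q = 1} =
        (if j i = 1 then insert i {q \<in> V. j q = 1} else {q \<in> V. j q = 1})" by auto
    ultimately show ?thesis by simp
  qed
  have "col_poly n a j s i = (\<Sum>V\<in>A. X ^ card {q \<in> V. j q = 1}) +
      (\<Sum>V\<in>B. X ^ card {q \<in> insert i V. j q = 1})"
    unfolding col_poly_def eq using fin disj inj
    by (subst sum.union_disjoint) (auto simp: sum.reindex)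
  also have "(\<Sum>V\<in>B. X ^ card {q \<in> insert i V. j q = 1}) =
      X ^ of_bool (j i = 1) * (\<Sum>V\<in>B. X ^ card {q \<in> V. j q = 1})"
    unfolding sum_distrib_left by (rule sum.cong) (simp_all only: card power_add)
  finally show ?thesis
    by (auto simp: A_def B_def col_poly_def)
qed

lemma col_poly_cong:
  assumes "\<And>q. q \<in> {i..n} \<Longrightarrow> j q = j' q"
  shows "col_poly n a j s i = col_poly n a j' s i"
proof -
  have "cols_from n a j s i = cols_from n a j' s i"
    using assms by (auto simp: cols_from_def)
  moreover have "{q \<in> V. j q = 1} = {q \<in> V. j' q = 1}" if "V \<in> cols_from n a j' s i" for V
    using that assms by (auto simp: cols_from_def)
  ultimately show ?thesis by (simp add: col_poly_def)
qed

text \<open>Without horizontal edges every vertical edge is determined by what the row receives, and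
  no node branches.\<close>

lemma col_poly_zero: "i \<le> Suc n \<Longrightarrow> col_poly n a (\<lambda>_. 0) s i = 1"
proof (induction arbitrary: s rule: inc_induct)
  case base
  then show ?case by (rule col_poly_end)
next
  case (step i)
  then show ?case by (simp add: col_poly_step)
qed

section \<open>Blocks and the closed form for one column\<close>

text \<open>For a row \<open>i\<close> that receives nothing from above, this is the obstruction to
  a valid column: a horizontal edge has to be used before any source can supply it.\<close>

definition one_before_source :: "nat \<Rightarrow> (nat \<Rightarrow> nat) \<Rightarrow> (nat \<Rightarrow> nat) \<Rightarrow> nat \<Rightarrow> bool" where
  "one_before_source n a j i \<longleftrightarrow> (\<exists>q. i \<le> q \<and> q \<le> n \<and> j q = 1 \<and> (\<forall>r. i \<le> r \<and> r \<le> q \<longrightarrow> a r = 0))"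

lemma one_before_source_end: "\<not> one_before_source n a j (Suc n)"
  by (auto simp: one_before_source_def)

lemma one_before_source_step:
  assumes "i \<le> n"
  shows "one_before_source n a j i \<longleftrightarrow> a i = 0 \<and> (j i = 1 \<or> one_before_source n a j (Suc i))"
    (is "?L \<longleftrightarrow> ?R")
proof
  assume ?L
  then obtain q where q: "i \<le> q" "q \<le> n" "j q = 1" "\<And>r. i \<le> r \<Longrightarrow> r \<le> q \<Longrightarrow> a r = 0"
    by (auto simp: one_before_source_def)
  show ?R
  proof (cases "q = i")
    case False
    then have "one_before_source n a j (Suc i)"
      unfolding one_before_source_def by (intro exI[of _ q]) (use q in auto)
    with q show ?thesis by auto
  qed (use q in auto)
next
  assume R: ?R
  show ?L
  proof (cases "j i = 1")
    case True
    then show ?thesis unfolding one_before_source_def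
      by (intro exI[of _ i]) (use R assms in auto)
  next
    case False
    then obtain q where q: "Suc i \<le> q" "q \<le> n" "j q = 1" "\<And>r. Suc i \<le> r \<Longrightarrow> r \<le> q \<Longrightarrow> a r = 0"
      using R by (auto simp: one_before_source_def)
    have "a r = 0" if "i \<le> r" "r \<le> q" for r
      using q(4)[of r] R that by (cases "r = i") auto
    then show ?thesis unfolding one_before_source_def
      by (intro exI[of _ q]) (use q in auto)
  qed
qed

lemma less_block_end_iff:
  assumes "p \<le> n" "p \<le> q"
  shows "q < block_end n a p \<longleftrightarrow> q \<le> n \<and> (\<forall>r. p < r \<and> r \<le> q \<longrightarrow> a r = 0)"
proof -
  let ?P = "\<lambda>q. p < q \<and> (q = n + 1 \<or> (q \<le> n \<and> 0 < a q))"
  have top: "?P (n + 1)" using assms by auto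
  have P: "?P (block_end n a p)" unfolding block_end_def by (rule LeastI[of ?P, OF top])
  have least: "block_end n a p \<le> r" if "?P r" for r
    unfolding block_end_def by (rule Least_le[of ?P, OF that])
  show ?thesis
  proof
    assume q: "q < block_end n a p"
    have "q \<le> n" using least[OF top] q by simp
    moreover have "a r = 0" if "p < r" "r \<le> q" for r
      using least[of r] that q \<open>q \<le> n\<close> by force
    ultimately show "q \<le> n \<and> (\<forall>r. p < r \<and> r \<le> q \<longrightarrow> a r = 0)" by blast
  next
    assume "q \<le> n \<and> (\<forall>r. p < r \<and> r \<le> q \<longrightarrow> a r = 0)"
    then show "q < block_end n a p" using P by (metis not_less le_trans Suc_eq_plus1 not_less_eq_eq less_irrefl)
  qed
qed

lemma block_has_one_iff:
  assumes "p \<le> n"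
  shows "(\<exists>i. p \<le> i \<and> i < block_end n a p \<and> j i = 1) \<longleftrightarrow>
    j p = 1 \<or> one_before_source n a j (Suc p)"
proof -
  have "(\<exists>i. p \<le> i \<and> i < block_end n a p \<and> j i = 1) \<longleftrightarrow>
    (\<exists>q. p \<le> q \<and> q \<le> n \<and> (\<forall>r. p < r \<and> r \<le> q \<longrightarrow> a r = 0) \<and> j q = 1)"
    using less_block_end_iff[OF assms] by blast
  \<comment> \<open>Erasing the source at \<open>p\<close> makes its block a source-free run
    beginning at \<open>p\<close>, so that the one-row recursion applies.\<close>
  also have "\<dots> \<longleftrightarrow> one_before_source n (a(p := 0)) j p"
    unfolding one_before_source_def by (intro ex_cong1) (auto simp: order_le_less)
  also have "\<dots> \<longleftrightarrow> j p = 1 \<or> one_before_source n (a(p := 0)) j (Suc p)"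
    by (simp add: one_before_source_step[OF assms])
  also have "one_before_source n (a(p := 0)) j (Suc p) \<longleftrightarrow> one_before_source n a j (Suc p)"
    unfolding one_before_source_def by (intro ex_cong1) auto
  finally show ?thesis .
qed

text \<open>Restricts \<open>beta\<close> to blocks starting in rows \<open>i, \<dots>, n\<close>
  and phrases the block condition so that it can be computed row by row from below.\<close>

definition beta_from :: "nat \<Rightarrow> (nat \<Rightarrow> nat) \<Rightarrow> (nat \<Rightarrow> nat) \<Rightarrow> nat \<Rightarrow> nat" where
  "beta_from n j a i = card {p \<in> {i..n}. 0 < a p \<and> (j p = 1 \<or> one_before_source n a j (Suc p))}"

definition bones_from :: "nat \<Rightarrow> (nat \<Rightarrow> nat) \<Rightarrow> nat \<Rightarrow> nat" where
  "bones_from n j i = card {q \<in> {i..n}. j q = 1}"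

lemma card_filter_atLeastAtMost_step:
  assumes "i \<le> n"
  shows "card {p \<in> {i..n}. P p} = of_bool (P i) + card {p \<in> {Suc i..n}. P p}"
proof -
  have "{p \<in> {i..n}. P p} = (if P i then insert i {p \<in> {Suc i..n}. P p} else {p \<in> {Suc i..n}. P p})"
    using assms by (auto simp: Suc_le_eq order_le_less)
  then show ?thesis by simp
qed

lemma beta_from_eq: "beta n j a = beta_from n j a 1"
  unfolding beta_def beta_from_def
  by (intro arg_cong[of _ _ card] Collect_cong conj_cong refl block_has_one_iff) simp

lemma bones_from_eq: "bones n j = bones_from n j 1"
  by (simp add: bones_def bones_from_def)

text \<open>The powers of \<open>X\<close> on the left avoid truncated subtraction in the exponents.\<close>

lemma col_poly_closed_form:
  fixes a j :: "nat \<Rightarrow> nat"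
  assumes "i \<le> Suc n"
  defines "u \<equiv> one_before_source n a j"
  shows "beta_from n j a i + of_bool (u i) \<le> bones_from n j i"
    and "X ^ (beta_from n j a i + of_bool (u i)) * col_poly n a j True i =
           X ^ bones_from n j i * Y ^ (beta_from n j a i + of_bool (u i))"
    and "X ^ beta_from n j a i * col_poly n a j False i =
           (if u i then 0 else X ^ bones_from n j i * Y ^ beta_from n j a i)"
proof -
  \<comment> \<open>The recursion mixes both states, so the three claims are proved together. In the
    state \<open>True\<close> the rows before the next source act as the rest of a block, which
    counts as one more block if it contains a 1; hence \<open>of_bool (u i)\<close>.\<close>
  have "beta_from n j a i + of_bool (u i) \<le> bones_from n j i \<and>
      X ^ (beta_from n j a i + of_bool (u i)) * col_poly n a j True i =
           X ^ bones_from n j i * Y ^ (beta_from n j a i + of_bool (u i)) \<and>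
      X ^ beta_from n j a i * col_poly n a j False i =
           (if u i then 0 else X ^ bones_from n j i * Y ^ beta_from n j a i)"
    using assms(1)
  proof (induction rule: inc_induct)
    case base
    show ?case
      by (simp add: beta_from_def bones_from_def u_def one_before_source_end col_poly_end)
  next
    case (step i)
    then have i: "i \<le> n" by simp
    have be: "beta_from n j a i = of_bool (0 < a i \<and> (j i = 1 \<or> u (Suc i))) + beta_from n j a (Suc i)"
      unfolding beta_from_def u_def by (rule card_filter_atLeastAtMost_step[OF i])
    have bo: "bones_from n j i = of_bool (j i = 1) + bones_from n j (Suc i)"
      unfolding bones_from_def by (rule card_filter_atLeastAtMost_step[OF i])
    have ui: "u i \<longleftrightarrow> a i = 0 \<and> (j i = 1 \<or> u (Suc i))"
      unfolding u_def by (rule one_before_source_step[OF i])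
    define T F \<beta> b x y where "T = col_poly n a j True (Suc i)" and "F = col_poly n a j False (Suc i)"
      and "\<beta> = beta_from n j a (Suc i)" and "b = bones_from n j (Suc i)" and "x = X" and "y = Y"
    note st = col_poly_step[OF i, of a j, folded T_def F_def x_def]
    note IH = step.IH[folded T_def F_def \<beta>_def b_def x_def y_def]
    have y: "y = x + 1" by (simp add: x_def y_def one_pCons)
    show ?case
      unfolding be bo ui st x_def[symmetric] y_def[symmetric] \<beta>_def[symmetric] b_def[symmetric]
      using IH by (cases "u (Suc i)"; cases "0 < a i"; cases "j i = 1")
        (auto simp: y algebra_simps)
  qed
  then show "beta_from n j a i + of_bool (u i) \<le> bones_from n j i"
    and "X ^ (beta_from n j a i + of_bool (u i)) * col_poly n a j True i =
           X ^ bones_from n j i * Y ^ (beta_from n j a i + of_bool (u i))"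
    and "X ^ beta_from n j a i * col_poly n a j False i =
           (if u i then 0 else X ^ bones_from n j i * Y ^ beta_from n j a i)"
    by blast+
qed

text \<open>Row 1 is a source, so the obstruction is absent there, and the power of \<open>X\<close>
  on the left can be cancelled.\<close>

lemma col_poly_eq:
  assumes "0 < n" "0 < a 1"
  shows "beta n j a \<le> bones n j"
    and "col_poly n a j False 1 = X ^ (bones n j - beta n j a) * Y ^ beta n j a"
proof -
  have u: "\<not> one_before_source n a j 1"
    using assms by (simp add: one_before_source_step)
  note cf = col_poly_closed_form[of 1 n j a]
  show le: "beta n j a \<le> bones n j"
    using cf(1) u by (simp add: beta_from_eq bones_from_eq)
  have "X ^ beta n j a * col_poly n a j False 1 = X ^ bones n j * Y ^ beta n j a"
    using cf(3) u by (simp add: beta_from_eq bones_from_eq)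
  also have "\<dots> = X ^ beta n j a * (X ^ (bones n j - beta n j a) * Y ^ beta n j a)"
    using le by (simp flip: power_add mult.assoc)
  finally show "col_poly n a j False 1 = X ^ (bones n j - beta n j a) * Y ^ beta n j a"
    by simp
qed

section \<open>Summation over the horizontal edges\<close>

text \<open>Arbitrary index sets allow a sum over binary vectors to be built up one row at a
  time.\<close>

definition binary_on :: "nat set \<Rightarrow> (nat \<Rightarrow> nat) set" where
  "binary_on S = {j. (\<forall>i. j i \<in> {0, 1}) \<and> (\<forall>i. i \<notin> S \<longrightarrow> j i = 0)}"

lemma binary_on_empty: "binary_on {} = {\<lambda>_. 0}"
  by (auto simp: binary_on_def)

lemma binary_on_insert:
  "binary_on (insert i S) = binary_on S \<union> (\<lambda>j. j(i := 1)) ` binary_on S"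
proof (intro equalityI subsetI)
  fix j assume j: "j \<in> binary_on (insert i S)"
  show "j \<in> binary_on S \<union> (\<lambda>j. j(i := 1)) ` binary_on S"
  proof (cases "j i = 1 \<and> i \<notin> S")
    case True
    then have "j = (j(i := 0))(i := 1)" "j(i := 0) \<in> binary_on S"
      using j by (auto simp: binary_on_def)
    then show ?thesis by blast
  next
    case False
    then show ?thesis using j by (auto simp: binary_on_def)
  qed
qed (auto simp: binary_on_def; blast)

lemma finite_binary_on: "finite S \<Longrightarrow> finite (binary_on S)"
  by (induction rule: finite_induct) (simp_all add: binary_on_empty binary_on_insert)

lemma sum_binary_on_insert:
  assumes "finite S" "i \<notin> S"
  shows "(\<Sum>j\<in>binary_on (insert i S). f j) = (\<Sum>j\<in>binary_on S. f j + f (j(i := 1)))"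
proof -
  have j0: "j i = 0" if "j \<in> binary_on S" for j using that assms by (auto simp: binary_on_def)
  have "inj_on (\<lambda>j. j(i := 1)) (binary_on S)"
  proof (rule inj_onI)
    fix j k assume jk: "j \<in> binary_on S" "k \<in> binary_on S" "j(i := 1) = k(i := 1)"
    then have "(j(i := 1))(i := 0) = (k(i := 1))(i := 0)" by simp
    then show "j = k" using j0[OF jk(1)] j0[OF jk(2)] by (simp add: fun_upd_idem)
  qed
  moreover have "binary_on S \<inter> (\<lambda>j. j(i := 1)) ` binary_on S = {}"
    using j0 by force
  ultimately show ?thesis
    unfolding binary_on_insert using finite_binary_on[OF assms(1)]
    by (subst sum.union_disjoint) (auto simp: sum.reindex sum.distrib)
qed

lemma binvecs_eq: "binvecs n = binary_on {1..n}"
  by (simp add: binvecs_def binary_on_def)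

definition cols_sum :: "nat \<Rightarrow> (nat \<Rightarrow> nat) \<Rightarrow> bool \<Rightarrow> nat \<Rightarrow> int poly" where
  "cols_sum n a s i = (\<Sum>j\<in>binary_on {i..n}. col_poly n a j s i)"

lemma cols_sum_end: "cols_sum n a s (Suc n) = 1"
  by (simp add: cols_sum_def binary_on_empty col_poly_end)

text \<open>If row \<open>i\<close> receives flow, \<open>j i = 0\<close> contributes the sum for
  \<open>True\<close>, and \<open>j i = 1\<close> the sum for \<open>False\<close> plus
  \<open>X\<close> times that for \<open>True\<close>; together the latter gets the factor
  \<open>X + 1 = Y\<close>. If it receives nothing, only \<open>j i = 0\<close> survives.\<close>

lemma cols_sum_step:
  assumes "i \<le> n"
  shows "cols_sum n a s i = cols_sum n a False (Suc i) +
    (if 0 < a i \<or> s then Y * cols_sum n a True (Suc i) else 0)"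
    (is "_ = ?rhs")
proof -
  have ivl: "{i..n} = insert i {Suc i..n}" using assms by auto
  have upd: "col_poly n a (j(i := 1)) t (Suc i) = col_poly n a j t (Suc i)" for j t
    by (rule col_poly_cong) auto
  have "cols_sum n a s i =
      (\<Sum>j\<in>binary_on {Suc i..n}. col_poly n a j s i + col_poly n a (j(i := 1)) s i)"
    unfolding cols_sum_def ivl by (rule sum_binary_on_insert) auto
  also have "\<dots> = (\<Sum>j\<in>binary_on {Suc i..n}. col_poly n a j False (Suc i) +
      (if 0 < a i \<or> s then Y * col_poly n a j True (Suc i) else 0))"
  proof (rule sum.cong)
    fix j assume "j \<in> binary_on {Suc i..n}"
    then have "j i = 0" by (auto simp: binary_on_def)
    then show "col_poly n a j s i + col_poly n a (j(i := 1)) s i = col_poly n a j False (Suc i) +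
        (if 0 < a i \<or> s then Y * col_poly n a j True (Suc i) else 0)"
      by (simp add: col_poly_step[OF assms] upd Y_eq fun_upd_same algebra_simps del: fun_upd_apply One_nat_def)
  qed simp
  also have "\<dots> = ?rhs"
    by (simp add: cols_sum_def sum.distrib sum_distrib_left)
  finally show ?thesis .
qed

section \<open>Signatures and the product formula\<close>

definition sources_from :: "nat \<Rightarrow> (nat \<Rightarrow> nat) \<Rightarrow> nat \<Rightarrow> nat list" where
  "sources_from n v i = filter (\<lambda>i. 0 < v i) [i..<n+1]"

definition signature_from :: "nat \<Rightarrow> (nat \<Rightarrow> nat) \<Rightarrow> nat \<Rightarrow> nat list" where
  "signature_from n v i =
     map2 (\<lambda>q p. q - p) (tl (sources_from n v i) @ [n+1]) (sources_from n v i)"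

text \<open>The default \<open>n + 1\<close> is the same end marker that closes the last gap of a
  signature.\<close>

definition next_source :: "nat \<Rightarrow> (nat \<Rightarrow> nat) \<Rightarrow> nat \<Rightarrow> nat" where
  "next_source n v i = hd (sources_from n v i @ [n+1])"

lemma next_source_ge: "i \<le> Suc n \<Longrightarrow> i \<le> next_source n v i"
proof -
  assume i: "i \<le> Suc n"
  have "next_source n v i \<in> set (sources_from n v i @ [n+1])"
    unfolding next_source_def by (rule hd_in_set) simp
  then show ?thesis using i by (auto simp: sources_from_def)
qed

lemma signature_from_step:
  assumes "i \<le> n"
  shows "signature_from n v i =
    (if 0 < v i then [next_source n v (Suc i) - i] else []) @ signature_from n v (Suc i)"
    and "next_source n v i = (if 0 < v i then i else next_source n v (Suc i))"
proof -
  have "[i..<n+1] = i # [Suc i..<n+1]" using assms by (simp add: upt_conv_Cons)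
  then have *: "sources_from n v i =
      (if 0 < v i then i # sources_from n v (Suc i) else sources_from n v (Suc i))"
    unfolding sources_from_def by simp
  show "next_source n v i = (if 0 < v i then i else next_source n v (Suc i))"
    by (simp add: next_source_def *)
  show "signature_from n v i =
    (if 0 < v i then [next_source n v (Suc i) - i] else []) @ signature_from n v (Suc i)"
    by (cases "sources_from n v (Suc i)") (simp_all add: signature_from_def next_source_def *)
qed

text \<open>In the state \<open>True\<close> the recursion up to the next source produces a
  geometric sum in \<open>Y\<close>, with denominator \<open>Y - 1 = X\<close>. The powers of
  \<open>X\<close> on the left clear these denominators: one for each source, and one more for the
  incoming flow.\<close>

lemma cols_sum_signature:
  fixes a :: "nat \<Rightarrow> nat"
  assumes "i \<le> Suc n"
  defines "R \<equiv> \<lambda>i. \<Prod>c\<leftarrow>signature_from n a i. Y ^ (c + 1) - 1"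
    and "k \<equiv> \<lambda>i. length (signature_from n a i)"
  shows "X ^ k i * cols_sum n a False i = R i \<and>
         X ^ (k i + 1) * cols_sum n a True i = (Y ^ (next_source n a i - i + 1) - 1) * R i"
  using assms(1)
proof (induction rule: inc_induct)
  case base
  have "sources_from n a (Suc n) = []" by (simp add: sources_from_def)
  then show ?case
    by (simp add: R_def k_def signature_from_def next_source_def cols_sum_end one_pCons)
next
  case (step i)
  then have i: "i \<le> n" by simp
  define T F c x y where "T = cols_sum n a True (Suc i)" and "F = cols_sum n a False (Suc i)"
    and "c = next_source n a (Suc i) - Suc i" and "x = X" and "y = Y"
  have c: "next_source n a (Suc i) - i = Suc c"
    using next_source_ge[of "Suc i" n a] i by (simp add: c_def)
  have x: "x = y - 1" by (simp add: x_def y_def one_pCons)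
  have IH: "x ^ k (Suc i) * F = R (Suc i)"
    "x ^ (k (Suc i) + 1) * T = (y ^ (c + 1) - 1) * R (Suc i)"
    using step.IH by (simp_all only: T_def F_def c_def x_def y_def)
  \<comment> \<open>The value for a row that receives flow. It settles both states when row
    \<open>i\<close> is a source, and the state \<open>True\<close> otherwise.\<close>
  have key: "x ^ (k (Suc i) + 1) * (F + y * T) = (y ^ (Suc c + 1) - 1) * R (Suc i)"
  proof -
    have "x ^ (k (Suc i) + 1) * (F + y * T) =
        x * (x ^ k (Suc i) * F) + y * (x ^ (k (Suc i) + 1) * T)"
      by (simp add: algebra_simps)
    also have "\<dots> = (y ^ (Suc c + 1) - 1) * R (Suc i)"
      by (simp only: IH) (simp add: x algebra_simps)
    finally show ?thesis .
  qed
  note st = cols_sum_step[OF i, of a, folded T_def F_def y_def]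
  note sg = signature_from_step[OF i, of a]
  show ?case
  proof (cases "0 < a i")
    case True
    have k: "k i = k (Suc i) + 1" and R: "R i = (y ^ (Suc c + 1) - 1) * R (Suc i)"
      using True c by (simp_all add: k_def R_def sg(1) y_def)
    show ?thesis
      unfolding x_def[symmetric] y_def[symmetric] k R using key True
      by (simp add: st sg(2) x mult.assoc)
  next
    case False
    have k: "k i = k (Suc i)" and R: "R i = R (Suc i)"
      using False by (simp_all add: k_def R_def sg(1))
    show ?thesis
      unfolding x_def[symmetric] y_def[symmetric] k R using key False IH(1)
      by (simp add: st sg(2) c)
  qed
qed

lemma signature_from_eq: "signature n v = signature_from n v 1"
  by (simp add: signature_def signature_from_def sources_from_def Let_def)

section \<open>Decomposition into columns\<close>

fun up :: "vert \<Rightarrow> vert" where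
  "up (Node i j) = Node i (Suc j)"
| "up Sink = Sink"

text \<open>Embeds the smaller grid as the columns to the right of column 0, with the sink kept
  fixed.\<close>

definition shift_edge :: "vert \<times> vert \<Rightarrow> vert \<times> vert" where
  "shift_edge = map_prod up up"

lemma inj_shift_edge: "inj shift_edge"
proof -
  have "inj up"
  proof (rule injI)
    fix v w assume "up v = up w" then show "v = w" by (cases v; cases w) auto
  qed
  then show ?thesis unfolding shift_edge_def by (rule prod.inj_map) fact
qed

lemma shift_edge_hedge: "shift_edge (hedge i j) = hedge i (Suc j)"
  by (simp add: shift_edge_def hedge_def)

lemma shift_edge_vedge: "shift_edge (vedge n i j) = vedge n i (Suc j)"
  by (simp add: shift_edge_def vedge_def)

lemma hedge_0_neq_shift_edge: "hedge i 0 \<noteq> shift_edge e"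
  by (cases e; cases "fst e") (auto simp: shift_edge_def hedge_def)

lemma vedge_0_neq_shift_edge: "vedge n i 0 \<noteq> shift_edge e"
  by (cases e; cases "fst e") (auto simp: shift_edge_def vedge_def)

definition join :: "nat \<Rightarrow> (nat \<Rightarrow> nat) \<Rightarrow> nat set \<Rightarrow> (vert \<times> vert) set \<Rightarrow> (vert \<times> vert) set" where
  "join n j V H = (\<lambda>i. hedge i 0) ` {i. j i = 1} \<union> (\<lambda>i. vedge n i 0) ` V \<union> shift_edge ` H"

lemma hedge_in_join:
  "hedge i 0 \<in> join n j V H \<longleftrightarrow> j i = 1"
  "hedge i (Suc k) \<in> join n j V H \<longleftrightarrow> hedge i k \<in> H"
proof -
  show "hedge i 0 \<in> join n j V H \<longleftrightarrow> j i = 1"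
    using hedge_0_neq_shift_edge by (auto simp: join_def)
  have "hedge i (Suc k) \<in> join n j V H \<longleftrightarrow> shift_edge (hedge i k) \<in> shift_edge ` H"
    by (auto simp: join_def shift_edge_hedge)
  then show "hedge i (Suc k) \<in> join n j V H \<longleftrightarrow> hedge i k \<in> H"
    by (simp add: inj_image_mem_iff[OF inj_shift_edge])
qed

lemma vedge_in_join:
  "vedge n i 0 \<in> join n j V H \<longleftrightarrow> i \<in> V"
  "vedge n i (Suc k) \<in> join n j V H \<longleftrightarrow> vedge n i k \<in> H"
proof -
  show "vedge n i 0 \<in> join n j V H \<longleftrightarrow> i \<in> V"
    using vedge_0_neq_shift_edge by (auto simp: join_def)
  have "vedge n i (Suc k) \<in> join n j V H \<longleftrightarrow> shift_edge (vedge n i k) \<in> shift_edge ` H"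
    by (auto simp: join_def shift_edge_vedge)
  then show "vedge n i (Suc k) \<in> join n j V H \<longleftrightarrow> vedge n i k \<in> H"
    by (simp add: inj_image_mem_iff[OF inj_shift_edge])
qed

lemma shift_edge_in_join: "shift_edge e \<in> join n j V H \<longleftrightarrow> e \<in> H"
proof -
  have "shift_edge e \<in> join n j V H \<longleftrightarrow> shift_edge e \<in> shift_edge ` H"
    unfolding join_def using hedge_0_neq_shift_edge[of _ e] vedge_0_neq_shift_edge[of n _ e]
    by (metis (no_types, lifting) UnE UnI2 imageE)
  then show ?thesis by (simp add: inj_image_mem_iff[OF inj_shift_edge])
qed

lemma join_subset_gedges:
  assumes "0 < n" "j \<in> binvecs n" "V \<subseteq> {1..n}" "H \<subseteq> gedges n m"
  shows "join n j V H \<subseteq> gedges n (Suc m)"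
proof -
  have "i \<in> {1..n}" if "j i = 1" for i
    using assms(2) that unfolding binvecs_def by fastforce
  moreover have "shift_edge e \<in> gedges n (Suc m)" if "e \<in> gedges n m" for e
    using assms(1) that
    by (cases rule: gedges_cases)
       (auto simp: shift_edge_hedge shift_edge_vedge hedge_in_gedges_iff vedge_in_gedges_iff)
  ultimately show ?thesis
    using assms by (force simp: join_def hedge_in_gedges_iff vedge_in_gedges_iff)
qed

text \<open>The conditions on column 0 are those of \<open>cols_from\<close>. In the remaining
  columns the conditions are those of the smaller grid, where a horizontal edge leaving column 0
  takes the place of a source.\<close>

lemma admissible_join_iff:
  assumes "0 < n" "j \<in> binvecs n" "V \<subseteq> {1..n}" "H \<subseteq> gedges n m"
  shows "admissible n (Suc m) a (join n j V H) \<longleftrightarrow>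
    V \<in> cols_from n a j False 1 \<and> admissible n m j H"
proof -
  have j: "j i = 1 \<longleftrightarrow> 0 < j i" for i
  proof -
    have "j i \<in> {0, 1}" using assms(2) by (simp add: binvecs_def)
    then show ?thesis by auto
  qed
  have split: "(\<forall>k\<le>Suc m. P k) \<longleftrightarrow> P 0 \<and> (\<forall>k\<le>m. P (Suc k))" for P
    by (metis Suc_le_mono le0 not0_implies_Suc)
  let ?J = "join n j V H"
  \<comment> \<open>For \<open>k = 0\<close> the incoming horizontal edge is recorded by
    \<open>j\<close>, for larger \<open>k\<close> by \<open>H\<close>; this matches the source and
    edge terms of \<open>admissible n m j H\<close>.\<close>
  have prev: "hedge i k \<in> ?J \<longleftrightarrow> k = 0 \<and> 0 < j i \<or> k \<noteq> 0 \<and> hedge i (k - 1) \<in> H" for i k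
    by (cases k) (simp_all add: hedge_in_join j del: One_nat_def)
  have "admissible n (Suc m) a ?J \<longleftrightarrow>
      (\<forall>i\<in>{1..n}. j i = 1 \<or> i \<in> V \<longleftrightarrow> 0 < a i \<or> i \<noteq> 1 \<and> i - 1 \<in> V) \<and>
      (\<forall>i\<in>{1..n}. \<forall>k\<le>m. hedge i k \<in> H \<or> vedge n i k \<in> H \<longleftrightarrow>
         hedge i k \<in> ?J \<or> i \<noteq> 1 \<and> vedge n (i - 1) k \<in> H)"
    using join_subset_gedges[OF assms] unfolding admissible_def split ball_conj_distrib
    by (simp add: hedge_in_join vedge_in_join del: One_nat_def)
  also have "(\<forall>i\<in>{1..n}. j i = 1 \<or> i \<in> V \<longleftrightarrow> 0 < a i \<or> i \<noteq> 1 \<and> i - 1 \<in> V) \<longleftrightarrow>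
      V \<in> cols_from n a j False 1"
  proof -
    have "(if i = 1 then False else i - 1 \<in> V) \<longleftrightarrow> i \<noteq> 1 \<and> i - 1 \<in> V" for i by simp
    then show ?thesis using assms(3) by (simp only: cols_from_def mem_Collect_eq simp_thms)
  qed
  also have "(\<forall>i\<in>{1..n}. \<forall>k\<le>m. hedge i k \<in> H \<or> vedge n i k \<in> H \<longleftrightarrow>
         hedge i k \<in> ?J \<or> i \<noteq> 1 \<and> vedge n (i - 1) k \<in> H) \<longleftrightarrow> admissible n m j H"
    unfolding prev admissible_def using assms(4) by (simp only: disj_assoc simp_thms)
  finally show ?thesis .
qed

text \<open>Supplies the preimages for surjectivity of \<open>join\<close>: every edge leaves column
  0 or is a shifted edge of the smaller grid.\<close>

lemma subset_gedges_eq_join: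
  assumes "0 < n" "H \<subseteq> gedges n (Suc m)"
  defines "j \<equiv> \<lambda>i. of_bool (hedge i 0 \<in> H)"
    and "V \<equiv> {i. vedge n i 0 \<in> H}" and "H' \<equiv> shift_edge -` H"
  shows "H = join n j V H'" "j \<in> binvecs n" "V \<subseteq> {1..n}" "H' \<subseteq> gedges n m"
proof -
  show "j \<in> binvecs n"
    using assms hedge_in_gedges_iff[OF assms(1)] by (force simp: binvecs_def j_def)
  show "V \<subseteq> {1..n}"
    using assms(2) vedge_in_gedges_iff[OF assms(1)] by (force simp: V_def)
  have cases: "(\<exists>i. e = hedge i 0) \<or> (\<exists>i. e = vedge n i 0) \<or> (\<exists>e'\<in>gedges n m. e = shift_edge e')"
    if "e \<in> gedges n (Suc m)" for e
    using assms(1) that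
  proof (cases rule: gedges_cases)
    case (hedge i k)
    then show ?thesis
      by (cases k) (auto simp: hedge_in_gedges_iff[OF assms(1)] intro!: bexI[of _ "hedge i (k - 1)"]
          simp flip: shift_edge_hedge)
  next
    case (vedge i k)
    then show ?thesis
      by (cases k) (auto simp: vedge_in_gedges_iff[OF assms(1)] intro!: bexI[of _ "vedge n i (k - 1)"]
          simp flip: shift_edge_vedge)
  qed
  show "H' \<subseteq> gedges n m"
  proof
    fix e assume "e \<in> H'"
    then have "shift_edge e \<in> gedges n (Suc m)" using assms(2) by (auto simp: H'_def)
    from cases[OF this] show "e \<in> gedges n m"
      using hedge_0_neq_shift_edge vedge_0_neq_shift_edge injD[OF inj_shift_edge] by metis
  qed
  show "H = join n j V H'"
  proof (intro equalityI subsetI)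
    fix e assume e: "e \<in> H"
    then have "e \<in> gedges n (Suc m)" using assms(2) by auto
    from cases[OF this] e show "e \<in> join n j V H'"
      by (auto simp: hedge_in_join vedge_in_join shift_edge_in_join j_def V_def H'_def)
  next
    fix e assume "e \<in> join n j V H'"
    then show "e \<in> H" by (auto simp: join_def j_def V_def H'_def simp del: One_nat_def)
  qed
qed

lemma join_inject:
  assumes "j \<in> binvecs n" "j' \<in> binvecs n" "join n j V H = join n j' V' H'"
  shows "j = j' \<and> V = V' \<and> H = H'"
proof (intro conjI)
  have eq: "j i = 1 \<longleftrightarrow> j' i = 1" for i using assms(3) by (metis hedge_in_join(1))
  show "j = j'"
  proof
    fix i
    have "j i \<in> {0, 1}" "j' i \<in> {0, 1}" using assms(1,2) by (auto simp: binvecs_def)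
    then show "j i = j' i" using eq[of i] by auto
  qed
  show "V = V'" using assms(3) by (metis vedge_in_join(1) subsetI subset_antisym)
  show "H = H'" using assms(3) by (metis shift_edge_in_join subsetI subset_antisym)
qed

lemma card_branch_join:
  assumes "0 < n" "V \<subseteq> {1..n}" "H \<subseteq> gedges n m"
  shows "card (branch n (join n j V H)) = card {q \<in> V. j q = 1} + card (branch n H)"
proof -
  have "branch n (join n j V H) =
      (\<lambda>i. (i, 0)) ` {q \<in> V. j q = 1} \<union> (\<lambda>(i, k). (i, Suc k)) ` branch n H" (is "_ = ?A \<union> ?B")
  proof (intro set_eqI)
    fix x :: "nat \<times> nat"
    obtain i k where x: "x = (i, k)" by (cases x)
    show "x \<in> branch n (join n j V H) \<longleftrightarrow> x \<in> ?A \<union> ?B"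
      unfolding x by (cases k) (force simp: branch_def hedge_in_join vedge_in_join)+
  qed
  moreover have "finite V" using assms(2) finite_subset by blast
  moreover have "finite (branch n H)" using finite_branch[OF assms(1,3)] .
  moreover have "?A \<inter> ?B = {}" by auto
  moreover have "card ?A = card {q \<in> V. j q = 1}"
    by (rule card_image) (auto simp: inj_on_def)
  moreover have "card ?B = card (branch n H)"
    by (rule card_image) (auto simp: inj_on_def)
  ultimately show ?thesis by (simp add: card_Un_disjoint)
qed

section \<open>Generating polynomial of the face numbers\<close>

text \<open>The generating polynomial of the nonempty faces by dimension, written as a sum over
  supports.\<close>

definition face_poly :: "nat \<Rightarrow> nat \<Rightarrow> (nat \<Rightarrow> nat) \<Rightarrow> int poly" where
  "face_poly n m a = (\<Sum>H | admissible n m a H. X ^ card (branch n H))"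

lemma finite_admissible: "0 < n \<Longrightarrow> finite {H. admissible n m a H}"
  by (rule finite_subset[of _ "Pow (gedges n m)"]) (auto simp: admissible_def finite_gedges)

lemma coeff_X_power: "coeff (X ^ k) d = (if k = d then 1 else 0)"
  using coeff_monom[of "1::int" k d] by (simp add: monom_altdef)

lemma coeff_face_poly: "0 < n \<Longrightarrow> coeff (face_poly n m a) d = int (face_count n m a (int d))"
proof -
  assume n: "0 < n"
  have "coeff (face_poly n m a) d =
      (\<Sum>H\<in>{H. admissible n m a H}. if card (branch n H) = d then 1 else 0)"
    by (simp add: face_poly_def coeff_sum coeff_X_power)
  also have "\<dots> = (\<Sum>H\<in>{H \<in> {H. admissible n m a H}. card (branch n H) = d}. 1)"
    by (rule sum.inter_filter[symmetric]) (rule finite_admissible[OF n])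
  also have "\<dots> = int (card {H. admissible n m a H \<and> card (branch n H) = d})" by simp
  finally show ?thesis by (simp add: face_count_eq_card_admissible[OF n])
qed

text \<open>\<open>join\<close> is a bijection from triples \<open>(j, V, H)\<close> onto the
  admissible sets of the larger grid, and branching nodes add up over the two pieces, so the weights
  multiply.\<close>

lemma face_poly_Suc:
  assumes n: "0 < n"
  shows "face_poly n (Suc m) a = (\<Sum>j\<in>binvecs n. col_poly n a j False 1 * face_poly n m j)"
proof -
  let ?D = "SIGMA j:binvecs n. cols_from n a j False 1 \<times> {H. admissible n m j H}"
  let ?f = "\<lambda>(j, V, H). join n j V H"
  have D: "j \<in> binvecs n" "V \<subseteq> {1..n}" "H \<subseteq> gedges n m" "V \<in> cols_from n a j False 1"
      "admissible n m j H" if "(j, V, H) \<in> ?D" for j V H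
    using that by (auto simp: cols_from_def admissible_def)
  have inj: "inj_on ?f ?D"
  proof (rule inj_onI)
    fix x y assume xy: "x \<in> ?D" "y \<in> ?D" "?f x = ?f y"
    obtain j V H j' V' H' where eqs: "x = (j, V, H)" "y = (j', V', H')" by (cases x; cases y)
    have "j \<in> binvecs n" "j' \<in> binvecs n" using D(1) xy(1,2) unfolding eqs by blast+
    then show "x = y" using join_inject[of j n j' V H V' H'] xy(3) unfolding eqs by simp
  qed
  have img: "?f ` ?D = {H. admissible n (Suc m) a H}"
  proof (intro equalityI subsetI)
    fix K assume "K \<in> ?f ` ?D"
    then obtain x where x: "x \<in> ?D" "K = ?f x" by blast
    obtain j V H where eq: "x = (j, V, H)" by (cases x)
    note jVH = D[OF x(1)[unfolded eq]]
    have "admissible n (Suc m) a (join n j V H)"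
      unfolding admissible_join_iff[OF n jVH(1-3)] using jVH(4,5) ..
    then show "K \<in> {H. admissible n (Suc m) a H}" by (simp add: x(2) eq)
  next
    fix K assume "K \<in> {H. admissible n (Suc m) a H}"
    then have K: "admissible n (Suc m) a K" by simp
    then have KE: "K \<subseteq> gedges n (Suc m)" by (simp add: admissible_def)
    define j where "j = (\<lambda>i. of_bool (hedge i 0 \<in> K) :: nat)"
    define V where "V = {i. vedge n i 0 \<in> K}"
    define H where "H = shift_edge -` K"
    have *: "K = join n j V H" "j \<in> binvecs n" "V \<subseteq> {1..n}" "H \<subseteq> gedges n m"
      using subset_gedges_eq_join[OF n KE] by (simp_all add: j_def V_def H_def)
    have "V \<in> cols_from n a j False 1 \<and> admissible n m j H"
      using K unfolding *(1) admissible_join_iff[OF n *(2-4)] .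
    then have "(j, V, H) \<in> ?D" using *(2) by simp
    then show "K \<in> ?f ` ?D" using *(1) by (intro image_eqI[of _ _ "(j, V, H)"]) simp_all
  qed
  have "face_poly n (Suc m) a = (\<Sum>x\<in>?D. X ^ card (branch n (?f x)))"
    unfolding face_poly_def img[symmetric] by (rule sum.reindex_cong[OF inj]) simp_all
  also have "\<dots> = (\<Sum>(j, V, H)\<in>?D. X ^ card {q \<in> V. j q = 1} * X ^ card (branch n H))"
  proof (rule sum.cong)
    fix x assume x: "x \<in> ?D"
    obtain j V H where x_eq: "x = (j, V, H)" by (cases x)
    note jVH = D[OF x[unfolded x_eq]]
    show "X ^ card (branch n (?f x)) =
        (case x of (j, V, H) \<Rightarrow> X ^ card {q \<in> V. j q = 1} * X ^ card (branch n H))"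
      using card_branch_join[OF n jVH(2,3)] unfolding x_eq by (simp add: power_add)
  qed simp
  also have "\<dots> = (\<Sum>j\<in>binvecs n. \<Sum>(V, H)\<in>cols_from n a j False 1 \<times> {H. admissible n m j H}.
      X ^ card {q \<in> V. j q = 1} * X ^ card (branch n H))"
    by (subst sum.Sigma)
       (auto simp: binvecs_eq finite_binary_on finite_cols_from finite_admissible[OF n] split_def)
  also have "\<dots> = (\<Sum>j\<in>binvecs n. col_poly n a j False 1 * face_poly n m j)"
    unfolding col_poly_def face_poly_def sum_product sum.cartesian_product ..
  finally show ?thesis .
qed

text \<open>The graph is a single directed path, so exactly one edge set is admissible and nothing
  branches. It is handled as a column without horizontal edges.\<close>

lemma face_poly_0:
  assumes n: "0 < n"
  shows "face_poly n 0 a = 1"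
proof -
  let ?C = "cols_from n a (\<lambda>_. 0) False 1"
  let ?f = "\<lambda>V. (\<lambda>i. vedge n i 0) ` V"
  have nh: "hedge i k \<notin> H" if "H \<subseteq> gedges n 0" for i k H
    using that hedge_in_gedges_iff[OF n, of i k 0] by auto
  have adm: "admissible n 0 a (?f V) \<longleftrightarrow> V \<in> ?C" if "V \<subseteq> {1..n}" for V
  proof -
    have "?f V \<subseteq> gedges n 0" using that n by (auto simp: vedge_in_gedges_iff)
    moreover have "i \<noteq> 1 \<and> i - 1 \<in> V \<longleftrightarrow> (if i = 1 then False else i - 1 \<in> V)" for i by auto
    moreover have "vedge n i 0 \<in> ?f V \<longleftrightarrow> i \<in> V" for i by auto
    ultimately show ?thesis
      using that nh[of "?f V"] by (simp add: admissible_def cols_from_def del: One_nat_def)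
  qed
  have "{H. admissible n 0 a H} = ?f ` ?C"
  proof (intro equalityI subsetI)
    fix H assume "H \<in> {H. admissible n 0 a H}"
    then have H: "admissible n 0 a H" "H \<subseteq> gedges n 0" by (auto simp: admissible_def)
    define V where "V = {i. vedge n i 0 \<in> H}"
    have "H \<subseteq> ?f V"
    proof
      fix e assume e: "e \<in> H"
      with H(2) have "e \<in> gedges n 0" by auto
      with n show "e \<in> ?f V"
        by (cases rule: gedges_cases) (use e in \<open>auto simp: V_def\<close>)
    qed
    then have eq: "H = ?f V" by (auto simp: V_def)
    have "V \<subseteq> {1..n}" using H(2) vedge_in_gedges_iff[OF n] by (force simp: V_def)
    then show "H \<in> ?f ` ?C" using adm[of V] H(1) eq by blast
  next
    fix H assume "H \<in> ?f ` ?C"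
    then obtain V where V: "V \<in> ?C" "H = ?f V" by blast
    then have "V \<subseteq> {1..n}" by (simp add: cols_from_def)
    then show "H \<in> {H. admissible n 0 a H}" using adm V by simp
  qed
  moreover have "inj_on ?f ?C"
    by (rule inj_onI) (auto dest: inj_image_eq_iff[THEN iffD1, rotated] simp: inj_def)
  moreover have "branch n (?f V) = {}" for V by (auto simp: branch_def)
  ultimately have "face_poly n 0 a = (\<Sum>V\<in>?C. 1)"
    by (simp add: face_poly_def sum.reindex)
  also have "\<dots> = col_poly n a (\<lambda>_. 0) False 1"
    by (simp add: col_poly_def)
  finally show ?thesis using n by (simp add: col_poly_zero)
qed

lemma coeff_Y_power: "coeff (Y ^ k) i = int (k choose i)"
proof (cases "i \<le> k")
  case False
  then have "degree (Y ^ k) < i" using degree_power_le[of Y k] by simp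
  then show ?thesis using False by (simp add: coeff_eq_0 binomial_eq_0)
qed (simp add: coeff_linear_poly_power)

section \<open>Extraction of coefficients\<close>

theorem theorem6p5:
  fixes n m d :: nat and a :: "nat \<Rightarrow> nat"
  assumes "0 < n" and "0 < m" and "0 < a 1" and "d \<le> n * m"
  shows "(1 < m \<longrightarrow>
            face_count n m a (int d) =
              (\<Sum>j\<in>binvecs n. \<Sum>k=0..d.
                 (beta n j a choose k) * face_count n (m - 1) j (int d - int k - gamma n j a)))
       \<and> (m = 1 \<longrightarrow>
            (\<forall>j\<in>binvecs n.
               int (face_count n 1 j (int d)) =
                 coeff (\<Prod>c\<leftarrow>signature n j. [:1, 1:] ^ (c + 1) - 1 :: int poly)
                       (d + length (signature n j))))"
proof (intro conjI impI ballI)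
  assume "1 < m"
  then obtain l where m: "m = Suc l" by (cases m) auto
  have coeff_j: "coeff (col_poly n a j False 1 * face_poly n l j) d =
      (\<Sum>k=0..d. int (beta n j a choose k) * int (face_count n l j (int d - int k - gamma n j a)))"
    for j
  proof -
    \<comment> \<open>By \<open>beta n j a \<le> bones n j\<close> the truncated difference agrees
      with the integer \<open>gamma n j a\<close>.\<close>
    define g where "g = bones n j - beta n j a"
    have g: "gamma n j a = int g"
      using col_poly_eq(1)[where a = a, OF assms(1,3)] by (simp add: gamma_def g_def of_nat_diff)
    have "coeff (col_poly n a j False 1 * face_poly n l j) d =
        coeff (monom 1 g * (Y ^ beta n j a * face_poly n l j)) d"
      unfolding col_poly_eq(2)[where a = a, OF assms(1,3)] g_def[symmetric]
      by (simp add: monom_altdef mult.assoc)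
    \<comment> \<open>The factor \<open>X ^ g\<close> shifts the coefficients by \<open>g\<close>;
      the rest is the convolution of binomial coefficients with face numbers.\<close>
    also have "\<dots> = (if d < g then 0 else
        \<Sum>k\<le>d - g. int (beta n j a choose k) * int (face_count n l j (int (d - g - k))))"
      by (simp only: coeff_monom_mult) (simp add: coeff_mult coeff_Y_power coeff_face_poly[OF assms(1)])
    also have "\<dots> = (\<Sum>k=0..d. int (beta n j a choose k) * int (face_count n l j (int d - int k - gamma n j a)))"
    proof (cases "d < g")
      case True
      then have "face_count n l j (int d - int k - gamma n j a) = 0" for k
        by (simp add: face_count_def g)
      then show ?thesis using True by simp
    next
      case False
      have "(\<Sum>k\<le>d - g. int (beta n j a choose k) * int (face_count n l j (int (d - g - k)))) =
          (\<Sum>k=0..d. int (beta n j a choose k) * int (face_count n l j (int d - int k - gamma n j a)))"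
      \<comment> \<open>The additional terms with \<open>k > d - g\<close> ask for faces of negative
        dimension and vanish.\<close>
      proof (rule sum.mono_neutral_cong_left)
        fix k assume "k \<in> {..d - g}"
        then have "int (d - g - k) = int d - int k - gamma n j a"
          using False by (simp add: g of_nat_diff)
        then show "int (beta n j a choose k) * int (face_count n l j (int (d - g - k))) =
            int (beta n j a choose k) * int (face_count n l j (int d - int k - gamma n j a))" by simp
      qed (use False in \<open>auto simp: face_count_def g\<close>)
      then show ?thesis using False by simp
    qed
    finally show ?thesis .
  qed
  have "int (face_count n m a (int d)) = coeff (face_poly n m a) d"
    by (simp add: coeff_face_poly[OF assms(1)])
  also have "\<dots> = int (\<Sum>j\<in>binvecs n. \<Sum>k=0..d.
      (beta n j a choose k) * face_count n l j (int d - int k - gamma n j a))"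
    unfolding m face_poly_Suc[OF assms(1)] coeff_sum coeff_j by simp
  finally show "face_count n m a (int d) = (\<Sum>j\<in>binvecs n. \<Sum>k=0..d.
      (beta n j a choose k) * face_count n (m - 1) j (int d - int k - gamma n j a))"
    unfolding m by (simp only: of_nat_eq_iff diff_Suc_1)
next
  fix j
  let ?k = "length (signature n j)"
  \<comment> \<open>What remains after removing column 0 is a path with polynomial 1, so only the
    sum over columns is left.\<close>
  have "face_poly n 1 j = cols_sum n j False 1"
    using face_poly_Suc[OF assms(1), of 0 j] face_poly_0[OF assms(1)]
    by (simp add: cols_sum_def binvecs_eq)
  then have "X ^ ?k * face_poly n 1 j = (\<Prod>c\<leftarrow>signature n j. Y ^ (c + 1) - 1)"
    using cols_sum_signature[of 1 n j] by (simp add: signature_from_eq)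
  \<comment> \<open>Clearing the denominators multiplied the polynomial by \<open>X ^ ?k\<close>,
    which moves the coefficient at \<open>d\<close> to \<open>d + ?k\<close>.\<close>
  then have "coeff (\<Prod>c\<leftarrow>signature n j. Y ^ (c + 1) - 1) (d + ?k) =
      coeff (monom 1 ?k * face_poly n 1 j) (d + ?k)"
    by (simp add: monom_altdef)
  also have "\<dots> = int (face_count n 1 j (int d))"
    by (simp add: coeff_monom_mult coeff_face_poly[OF assms(1)])
  finally show "int (face_count n 1 j (int d)) =
      coeff (\<Prod>c\<leftarrow>signature n j. [:1, 1:] ^ (c + 1) - 1 :: int poly) (d + ?k)" ..
qed

end
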